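(* Let $q\ge 25$ be a prime power and let $\mathcal L$ be a set of planes of ${\rm PG}(5,q)$, non-empty and not containing all planes. Put $\lambda_2=q^3-q-1$ and $x=(q+1)^2$, and suppose $|\mathcal L|=x(q^2+1)(q^2-q+1)$, every plane of $\mathcal L$ meets exactly $\lambda_2+x$ other planes of $\mathcal L$ in a line, and every plane not in $\mathcal L$ meets exactly $x$ planes of $\mathcal L$ in a line. Suppose that every line and every solid is incident with at most $x$ planes of $\mathcal L$, and that for every solid containing exactly $q+1$ planes of $\mathcal L$, these $q+1$ planes contain a common line. Then $\mathcal L$ is the set of planes of a symplectic polar space $W(5,q)$ embedded in ${\rm PG}(5,q)$.
   Context: A plane is a 2-dimensional and a solid a 3-dimensional projective subspace of ${\rm PG}(5,q)$. $W(5,q)$ denotes the polar space of totally isotropic subspaces of a symplectic polarity of ${\rm PG}(5,q)$; its planes are the totally isotropic planes. *)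

theory Defs
  imports "HOL-Analysis.Cartesian_Space" "HOL-Library.Numeral_Type"
begin

text \<open>Projective subspaces of the projective space of the vector space \<open>'a ^ 'n\<close> are
  represented by the linear subspaces; the projective dimension is one less than the vector space
  dimension, and incidence is inclusion. Thus PG(5,q) lives on \<open>'a ^ 6\<close> for a finite field
  \<open>'a\<close> with q elements.\<close>

definition proj_subspaces :: "nat \<Rightarrow> ('a::field ^ 'n) set set" where
  "proj_subspaces k = {U. vec.subspace U \<and> vec.dim U = k + 1}"

abbreviation pg_points :: "('a::field ^ 'n) set set" where "pg_points \<equiv> proj_subspaces 0"
abbreviation pg_lines :: "('a::field ^ 'n) set set" where "pg_lines \<equiv> proj_subspaces 1"
abbreviation pg_planes :: "('a::field ^ 'n) set set" where "pg_planes \<equiv> proj_subspaces 2"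
abbreviation pg_solids :: "('a::field ^ 'n) set set" where "pg_solids \<equiv> proj_subspaces 3"

text \<open>Only the values of \<open>\<rho>\<close> on subspaces are relevant.\<close>

definition polarity :: "(('a::field ^ 'n) set \<Rightarrow> ('a ^ 'n) set) \<Rightarrow> bool" where
  "polarity \<rho> \<longleftrightarrow>
     (\<forall>U. vec.subspace U \<longrightarrow> vec.subspace (\<rho> U)) \<and>
     (\<forall>U W. vec.subspace U \<longrightarrow> vec.subspace W \<longrightarrow> U \<subseteq> W \<longrightarrow> \<rho> W \<subseteq> \<rho> U) \<and>
     (\<forall>U. vec.subspace U \<longrightarrow> \<rho> (\<rho> U) = U)"

text \<open>A polarity is symplectic (a null polarity) if every point is absolute.\<close>

definition symplectic_polarity :: "(('a::field ^ 'n) set \<Rightarrow> ('a ^ 'n) set) \<Rightarrow> bool" where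
  "symplectic_polarity \<rho> \<longleftrightarrow> polarity \<rho> \<and> (\<forall>P\<in>pg_points. P \<subseteq> \<rho> P)"

definition totally_isotropic ::
  "(('a::field ^ 'n) set \<Rightarrow> ('a ^ 'n) set) \<Rightarrow> ('a ^ 'n) set \<Rightarrow> bool" where
  "totally_isotropic \<rho> U \<longleftrightarrow> vec.subspace U \<and> U \<subseteq> \<rho> U"

definition symplectic_polar_space ::
  "(('a::field ^ 'n) set \<Rightarrow> ('a ^ 'n) set) \<Rightarrow> ('a ^ 'n) set set" where
  "symplectic_polar_space \<rho> = {U. totally_isotropic \<rho> U}"

end

theory Submission imports Defs begin

text \<open>
Put $K$ for the largest number of planes of $L$ on a line or in a solid. By duality it is attained
at a solid $S$. For a line $l$ of $S$ let $t_l$ be the number of planes $E \in L$ with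
$l \subseteq E \subseteq S$, and $e_l$ the number of planes of $L$ meeting $S$ exactly in $l$. The
hypotheses determine $\sum_{l \subseteq E} e_l$ for every plane $E$ of $S$, hence also
$\sum e_l = (q+1)N$, $\sum e_l t_l = KN$ and $\sum t_l(t_l-1) = K(K-1)$, where
$N = q^3+q^2+q+1-K$. By Cauchy-Schwarz $\sum e_l t_l(t_l-1)$ is large, while $e_l \le K - t_l$ and,
for $t_l \le q$, also $e_l \le (q+1)^2-K$. This forces $K \le q+1$, once the lines with $t_l = q+1$
are shown to be few. As the lines in a plane of $L$ lie on $q+1$ planes of $L$ on average, every line
and every solid is incident with $0$ or $q+1$ planes of $L$. Counting in the quotient at a point $P$
then shows that the lines through $P$ lying on planes of $L$ fill a hyperplane $P^\perp$, and
$P \mapsto P^\perp$ is the required polarity.\<close>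

section \<open>Subspaces and orthogonality\<close>

text \<open>The neighbour hypothesis is self-dual, which is why the bound may be sought at a solid;
  the pencil hypothesis is not, and it enters only after the bound, in the quotient at a point.
  Maximality of \<open>K\<close> over lines and solids together is what gives
  \<open>e_l <= K - t_l\<close>. The bound \<open>(q+1)^2 - K\<close> comes from a plane of
  \<open>S\<close> on \<open>l\<close> outside \<open>L\<close>; if \<open>t_l = q + 1\<close> there
  is no such plane, and this is the obstacle posed by these lines. The two bounds balance near
  \<open>K = (q+1)^2 / 2\<close>, hence a light and a heavy case. With weights \<open>e_l\<close>
  the mean of \<open>t_l\<close> is \<open>K / (q+1)\<close>, so Cauchy-Schwarz is used as
  nonnegativity of the weighted sum of \<open>((q+1) t_l - K)^2\<close>. For
  \<open>K = q + 2\<close> this mean barely exceeds 1 and the estimate fails; there integrality, as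
  \<open>(t_l - 1)(t_l - 2) >= 0\<close>, takes its place. In the quotient, a PG(4,q), the pencil
  hypothesis makes every plane meet the point set in question in \<open>q + 1\<close> points or lie
  inside it; together with the size of the set this forces a hyperplane.\<close>

definition subs :: "nat \<Rightarrow> ('a::field ^ 'n) set set" where
  "subs k = {U. vec.subspace U \<and> vec.dim U = k}"

lemma proj_subspaces_eq_subs: "proj_subspaces k = subs (Suc k)"
  by (simp add: proj_subspaces_def subs_def)

lemma subs_subspace: "U \<in> subs k \<Longrightarrow> vec.subspace U"
  and subs_dim: "U \<in> subs k \<Longrightarrow> vec.dim U = k"
  by (simp_all add: subs_def)

lemma subs_eqI:
  assumes "U \<in> subs k" "W \<in> subs k" "U \<subseteq> W" shows "U = W"
  using assms vec.subspace_dim_equal by (metis order_refl subs_dim subs_subspace)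

lemma subs_dim_le: "U \<in> subs j \<Longrightarrow> W \<in> subs k \<Longrightarrow> U \<subseteq> W \<Longrightarrow> j \<le> k"
  using vec.dim_subset subs_dim by metis

definition join :: "('a::field ^ 'n) set \<Rightarrow> ('a ^ 'n) set \<Rightarrow> ('a ^ 'n) set" where
  "join U W = vec.span (U \<union> W)"

lemma subspace_join [simp]: "vec.subspace (join U W)"
  by (simp add: join_def)

lemma join_upper1: "U \<subseteq> join U W" and join_upper2: "W \<subseteq> join U W"
  by (auto simp: join_def intro: vec.span_base)

lemma join_least: "vec.subspace V \<Longrightarrow> U \<subseteq> V \<Longrightarrow> W \<subseteq> V \<Longrightarrow> join U W \<subseteq> V"
  unfolding join_def by (simp add: vec.span_minimal)

lemma dim_join_Int:
  assumes "vec.subspace U" "vec.subspace W"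
  shows "vec.dim (join U W) + vec.dim (U \<inter> W) = vec.dim U + vec.dim W"
proof -
  have "join U W = {x + y |x y. x \<in> U \<and> y \<in> W}"
    using assms by (force simp: join_def vec.span_Un vec.span_eq_iff[THEN iffD2])
  then show ?thesis using vec.dim_sums_Int[OF assms] by simp
qed

text \<open>Later incidence arguments take this \<open>k\<close> and exclude all values but one by
  containments. Since \<open>k\<close> is at most \<open>i\<close> and \<open>j\<close>, the
  subtraction never truncates.\<close>

lemma subs_Int_join:
  assumes "U \<in> subs i" "W \<in> subs j"
  shows "\<exists>k. U \<inter> W \<in> subs k \<and> k \<le> i \<and> k \<le> j \<and> join U W \<in> subs (i + j - k)"
proof -
  have sub: "vec.subspace U" "vec.subspace W" using assms by (auto simp: subs_def)
  have "vec.subspace (U \<inter> W)" using sub by (rule vec.subspace_inter)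
  moreover have "vec.dim (U \<inter> W) \<le> i" "vec.dim (U \<inter> W) \<le> j"
    using assms vec.dim_subset[of "U \<inter> W" U] vec.dim_subset[of "U \<inter> W" W] by (auto simp: subs_def)
  moreover have "vec.dim (join U W) = i + j - vec.dim (U \<inter> W)"
    using dim_join_Int[OF sub] assms by (simp add: subs_def)
  ultimately show ?thesis by (simp add: subs_def)
qed

lemma subs_Int_join_iff:
  assumes "U \<in> subs i" "W \<in> subs j" "k + m = i + j"
  shows "U \<inter> W \<in> subs k \<longleftrightarrow> join U W \<in> subs m"
proof -
  have "vec.subspace (U \<inter> W)" using assms by (simp add: subs_def vec.subspace_inter)
  then show ?thesis
    using dim_join_Int[of U W] assms by (auto simp: subs_def)
qed

section \<open>Counting vectors and covers of a subspace\<close>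

text \<open>Each new basis vector \<open>b\<close> multiplies the size by the number of scalars: a
  vector of the larger span is \<open>c *s b + u\<close> for exactly one pair, because
  \<open>b\<close> lies outside the old span.\<close>

lemma card_subspace:
  fixes U :: "('a::{field,finite} ^ 'n) set"
  assumes "vec.subspace U"
  shows "card U = CARD('a) ^ vec.dim U"
proof -
  have *: "card (vec.span B) = CARD('a) ^ card B"
    if "finite B" "vec.independent B" for B :: "('a ^ 'n) set"
    using that
  proof (induction B rule: finite_induct)
    case empty
    then show ?case by simp
  next
    case (insert b B)
    have ind: "vec.independent B" and nb: "b \<notin> vec.span B"
      using insert.prems insert.hyps by (auto simp: vec.independent_insert)
    have sub: "vec.subspace (vec.span B)" by simp
    let ?f = "\<lambda>(c, u). c *s b + u"
    have "inj_on ?f (UNIV \<times> vec.span B)"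
    proof (rule inj_onI, clarify)
      fix c u d w assume uw: "u \<in> vec.span B" "w \<in> vec.span B" and eq: "c *s b + u = d *s b + w"
      have "(c - d) *s b = w - u"
        using eq by (simp add: vector_sub_rdistrib algebra_simps)
      then have mem: "(c - d) *s b \<in> vec.span B" using uw by (simp add: vec.span_diff)
      have "c = d"
      proof (rule ccontr)
        assume "c \<noteq> d"
        then have "b = inverse (c - d) *s ((c - d) *s b)" by simp
        then show False using mem nb vec.span_scale by metis
      qed
      then show "c = d \<and> u = w" using eq by simp
    qed
    moreover have "?f ` (UNIV \<times> vec.span B) = vec.span (insert b B)"
    proof (intro equalityI subsetI)
      fix v assume "v \<in> ?f ` (UNIV \<times> vec.span B)"
      then show "v \<in> vec.span (insert b B)"
        by (auto simp: vec.span_breakdown_eq) (metis add_diff_cancel_left')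
    next
      fix v assume "v \<in> vec.span (insert b B)"
      then obtain k where "v - k *s b \<in> vec.span B" by (auto simp: vec.span_breakdown_eq)
      then show "v \<in> ?f ` (UNIV \<times> vec.span B)"
        by (intro image_eqI[of _ _ "(k, v - k *s b)"]) auto
    qed
    ultimately have "card (vec.span (insert b B)) = card ((UNIV :: 'a set) \<times> vec.span B)"
      by (metis card_image)
    also have "\<dots> = CARD('a) ^ card (insert b B)"
      using insert.hyps insert.IH[OF ind] by (simp add: card_cartesian_product)
    finally show ?case .
  qed
  obtain B where "finite B" "vec.independent B" "vec.span B = U" "card B = vec.dim U"
    using vec.basis_subspace_exists[OF assms] by metis
  then show ?thesis using * by metis
qed

text \<open>Hence the covers of \<open>U\<close> partition the vectors outside \<open>U\<close>, on
  which the counts rest.\<close>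

lemma subs_covers_unique:
  assumes "U \<in> subs k" "W \<in> subs (Suc k)" "U \<subseteq> W" "v \<in> W" "v \<notin> U"
  shows "W = vec.span (insert v U)"
proof -
  have U: "vec.span U = U" using assms by (simp add: subs_def vec.span_eq_iff)
  have "vec.dim (vec.span (insert v U)) = Suc k"
    using assms U by (simp add: vec.dim_insert subs_def del: vec.span_eq_iff)
  then have "vec.span (insert v U) \<in> subs (Suc k)" by (simp add: subs_def)
  moreover have "vec.span (insert v U) \<subseteq> W"
    using assms by (simp add: subs_def vec.span_minimal)
  ultimately show ?thesis using assms(2) subs_eqI by blast
qed

text \<open>Each cover of \<open>U\<close> contains \<open>q^(k+1) - q^k\<close> of the
  \<open>q^m - q^k\<close> vectors of \<open>V - U\<close>, and no vector lies in two of them. The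
  dimensions are tied by equations so that the rule unifies with numerals.\<close>

lemma card_subs_covers:
  fixes U V :: "('a::{field,finite} ^ 'n) set"
  assumes U: "U \<in> subs k" and V: "V \<in> subs m" and UV: "U \<subseteq> V"
    and m: "m = k + j" and k': "k' = Suc k"
  shows "int (card {W \<in> subs k'. U \<subseteq> W \<and> W \<subseteq> V}) = (\<Sum>i<j. int CARD('a) ^ i)"
proof -
  let ?q = "int CARD('a)" and ?C = "{W \<in> subs k'. U \<subseteq> W \<and> W \<subseteq> V}"
  have q1: "?q > 1"
  proof -
    have "card {0::'a, 1} \<le> CARD('a)" by (intro card_mono) auto
    then show ?thesis by simp
  qed
  have diff: "int (card (W - U)) = ?q ^ m - ?q ^ k" if "W \<in> subs m" "U \<subseteq> W" for W m
  proof -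
    have "card U \<le> card W" using that by (intro card_mono) auto
    moreover have "card (W - U) = card W - card U" using that by (intro card_Diff_subset) auto
    ultimately show ?thesis using that U by (simp add: card_subspace subs_def of_nat_diff)
  qed
  have part: "V - U = (\<Union>W\<in>?C. W - U)"
  proof (intro equalityI subsetI)
    fix v assume v: "v \<in> V - U"
    let ?W = "vec.span (insert v U)"
    have "vec.span U = U" using U by (simp add: subs_def vec.span_eq_iff)
    then have "vec.dim ?W = Suc k" using U v \<open>vec.span U = U\<close> by (simp add: vec.dim_insert subs_def del: vec.span_eq_iff)
    moreover have "U \<subseteq> ?W" "v \<in> ?W" by (auto intro: vec.span_base)
    moreover have "?W \<subseteq> V" using V UV v by (simp add: subs_def vec.span_minimal)
    ultimately show "v \<in> (\<Union>W\<in>?C. W - U)" using v by (auto simp: subs_def k')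
  qed auto
  have "card (V - U) = (\<Sum>W\<in>?C. card (W - U))"
    unfolding part
  proof (intro card_UN_disjoint ballI impI)
    fix W W' assume W: "W \<in> ?C" and W': "W' \<in> ?C" and "W \<noteq> W'"
    have "W = W'" if "v \<in> W" "v \<in> W'" "v \<notin> U" for v
    proof -
      have "W = vec.span (insert v U)" "W' = vec.span (insert v U)"
        using W W' that subs_covers_unique[OF U] by (auto simp: k')
      then show ?thesis by simp
    qed
    then show "(W - U) \<inter> (W' - U) = {}" using \<open>W \<noteq> W'\<close> by blast
  qed auto
  then have "int (card (V - U)) = (\<Sum>W\<in>?C. int (card (W - U)))" by simp
  also have "\<dots> = (\<Sum>W\<in>?C. ?q ^ Suc k - ?q ^ k)"
    by (intro sum.cong refl diff) (auto simp: k')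
  finally have "?q ^ (k + j) - ?q ^ k = int (card ?C) * (?q ^ Suc k - ?q ^ k)"
    using diff[OF V UV] by (simp add: m)
  then have "?q ^ k * (?q ^ j - 1) = ?q ^ k * (int (card ?C) * (?q - 1))"
    by (simp add: algebra_simps power_add)
  then have "?q ^ j - 1 = int (card ?C) * (?q - 1)" using q1 by simp
  moreover have "?q ^ j - 1 = (?q - 1) * (\<Sum>i<j. ?q ^ i)" by (rule power_diff_1_eq)
  ultimately show ?thesis using q1 by simp
qed

text \<open>A relation instead of a form: the locale is instantiated by the dot product and later by
  a relation read off from \<open>L\<close>, for which no bilinear form is at hand.\<close>

locale orthogonality =
  fixes orth :: "'a::field ^ 'n \<Rightarrow> 'a ^ 'n \<Rightarrow> bool"
  assumes orth_sym: "orth u w \<Longrightarrow> orth w u"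
    and subspace_orth: "vec.subspace {w. orth u w}"
    and dim_orth: "CARD('n) \<le> Suc (vec.dim {w. orth u w})"
    and orth_nondegenerate: "(\<And>w. orth u w) \<Longrightarrow> u = 0"
begin

definition perp :: "('a ^ 'n) set \<Rightarrow> ('a ^ 'n) set" where
  "perp U = {w. \<forall>u\<in>U. orth u w}"

lemma subspace_perp: "vec.subspace (perp U)"
proof -
  have "perp U = (\<Inter>u\<in>U. {w. orth u w})" by (auto simp: perp_def)
  then show ?thesis using subspace_orth by (auto intro!: vec.subspace_Inter)
qed

lemma perp_antimono: "U \<subseteq> W \<Longrightarrow> perp W \<subseteq> perp U"
  by (auto simp: perp_def)

lemma perp_span: "perp (vec.span U) = perp U"
proof (intro equalityI subsetI)
  fix w assume "w \<in> perp U"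
  then have "U \<subseteq> {u. orth w u}" using orth_sym by (auto simp: perp_def)
  then have "vec.span U \<subseteq> {u. orth w u}" using subspace_orth by (rule vec.span_minimal)
  then show "w \<in> perp (vec.span U)" using orth_sym by (auto simp: perp_def)
qed (auto simp: perp_def intro: vec.span_base)

lemma dim_perp_insert: "vec.dim (perp U) \<le> Suc (vec.dim (perp (insert v U)))"
proof -
  let ?H = "{w. orth v w}"
  have "perp (insert v U) = perp U \<inter> ?H" by (auto simp: perp_def)
  moreover have "vec.dim (join (perp U) ?H) \<le> CARD('n)"
    using vec.dim_subset[OF subset_UNIV] by (metis vec_dim_card)
  ultimately show ?thesis
    using dim_join_Int[OF subspace_perp subspace_orth, of U v] dim_orth[of v] by simp
qed

text \<open>Enlarging \<open>U\<close> by one vector raises its dimension by 1 and lowers that of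
  its perp by at most 1, as only one more subspace of codimension at most 1 is intersected.\<close>

lemma dim_perp_mono:
  assumes "vec.subspace U" "U \<subseteq> W" "vec.subspace W"
  shows "vec.dim (perp U) + vec.dim U \<le> vec.dim (perp W) + vec.dim W"
proof -
  have "\<exists>W'. vec.subspace W' \<and> U \<subseteq> W' \<and> W' \<subseteq> W \<and> vec.dim W' = vec.dim U + k \<and>
          vec.dim (perp U) \<le> vec.dim (perp W') + k" if "vec.dim U + k \<le> vec.dim W" for k
    using that
  proof (induction k)
    case 0
    then show ?case using assms by auto
  next
    case (Suc k)
    then obtain W' where W': "vec.subspace W'" "U \<subseteq> W'" "W' \<subseteq> W" "vec.dim W' = vec.dim U + k"
      "vec.dim (perp U) \<le> vec.dim (perp W') + k" by auto
    then obtain v where v: "v \<in> W" "v \<notin> W'"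
      using Suc.prems by (metis add_Suc_right not_less_eq_eq order_refl subsetI subset_antisym)
    let ?W = "vec.span (insert v W')"
    have sp: "vec.span W' = W'" using W' by (simp add: vec.span_eq_iff)
    have "?W \<subseteq> W" using assms W' v by (simp add: vec.span_minimal)
    moreover have "W' \<subseteq> ?W" by (auto intro: vec.span_base)
    moreover have "vec.dim ?W = vec.dim U + Suc k"
      using sp v W' by (simp add: vec.dim_insert del: vec.span_eq_iff)
    moreover have "vec.dim (perp U) \<le> vec.dim (perp ?W) + Suc k"
      using dim_perp_insert[of W' v] W' perp_span[of "insert v W'"] by simp
    ultimately show ?case using W' by (intro exI[of _ ?W]) auto
  qed
  from this[of "vec.dim W - vec.dim U"] obtain W' where W': "vec.subspace W'" "W' \<subseteq> W"
    "vec.dim W' = vec.dim W" "vec.dim (perp U) + vec.dim U \<le> vec.dim (perp W') + vec.dim W"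
    using vec.dim_subset[OF assms(2)] by auto
  then have "W' = W" using assms vec.subspace_dim_equal by (metis order_refl)
  then show ?thesis using W' by simp
qed

text \<open>The sum is monotone in \<open>U\<close> and takes the same value \<open>CARD('n)\<close>
  at \<open>{0}\<close> and at \<open>UNIV\<close>.\<close>

lemma dim_perp:
  assumes "vec.subspace U"
  shows "vec.dim (perp U) + vec.dim U = CARD('n)"
proof (rule antisym)
  have "perp UNIV = {0}"
    using orth_nondegenerate orth_sym vec.subspace_0[OF subspace_orth] by (force simp: perp_def)
  then show "vec.dim (perp U) + vec.dim U \<le> CARD('n)"
    using dim_perp_mono[OF assms, of UNIV] by (simp add: vec_dim_card del: vec.dim_UNIV)
  have "perp {0} = UNIV"
    using orth_sym vec.subspace_0[OF subspace_orth] by (force simp: perp_def)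
  then show "CARD('n) \<le> vec.dim (perp U) + vec.dim U"
    using dim_perp_mono[OF vec.subspace_single_0, of U] assms vec.subspace_0[OF assms]
    by (simp add: vec_dim_card del: vec.dim_UNIV)
qed

lemma perp_perp:
  assumes "vec.subspace U"
  shows "perp (perp U) = U"
proof -
  have "U \<subseteq> perp (perp U)" using orth_sym by (auto simp: perp_def)
  moreover have "vec.dim (perp (perp U)) = vec.dim U"
    using dim_perp[OF assms] dim_perp[OF subspace_perp, of U] by simp
  ultimately show ?thesis
    using assms subspace_perp vec.subspace_dim_equal by (metis order_refl)
qed

lemma perp_in_subs: "U \<in> subs k \<Longrightarrow> perp U \<in> subs (CARD('n) - k)"
  using dim_perp[of U] subspace_perp by (auto simp: subs_def)

lemma perp_subset_iff:
  assumes "vec.subspace U" "vec.subspace W"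
  shows "perp U \<subseteq> perp W \<longleftrightarrow> W \<subseteq> U"
  using perp_antimono perp_perp assms by metis

lemma perp_join: "perp (join U W) = perp U \<inter> perp W"
  unfolding join_def perp_span by (auto simp: perp_def)

lemma polarity_perp: "polarity perp"
  using subspace_perp perp_antimono perp_perp by (simp add: polarity_def)

end

section \<open>The standard duality\<close>

definition dot :: "'a::comm_ring_1 ^ 'n \<Rightarrow> 'a ^ 'n \<Rightarrow> 'a" where
  "dot u w = (\<Sum>i\<in>UNIV. u $ i * w $ i)"

lemma dot_commute: "dot u w = dot w u"
  by (simp add: dot_def mult.commute)

lemma dot_axis: "dot u (axis i c) = u $ i * c"
  unfolding dot_def
  by (subst sum.remove[of _ i]) (auto simp: axis_def intro!: sum.neutral)

lemma dot_add: "dot u (v + w) = dot u v + dot u w"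
  by (simp add: dot_def algebra_simps sum.distrib)

lemma dot_scale: "dot u (c *s w) = c * dot u w"
  by (simp add: dot_def algebra_simps sum_distrib_left)

text \<open>Provides \<open>dot.perp\<close>, the duality that exchanges lines and solids of PG(5,q)
  and maps planes to planes.\<close>

interpretation dot: orthogonality "\<lambda>u w :: 'a::field ^ 'n. dot u w = 0"
proof
  fix u :: "'a ^ 'n"
  let ?H = "{w. dot u w = 0}"
  show sub: "vec.subspace ?H"
    by (auto simp: vec.subspace_def dot_add dot_scale) (simp add: dot_def)
  show "CARD('n) \<le> Suc (vec.dim ?H)"
  proof (cases "u = 0")
    case True
    then have "?H = UNIV" by (auto simp: dot_def)
    then show ?thesis by (simp add: vec_dim_card del: vec.dim_UNIV)
  next
    case False
    then obtain i where i: "u $ i \<noteq> 0" by (auto simp: vec_eq_iff)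
    let ?e = "axis i (1::'a) :: 'a ^ 'n"
    have "w \<in> vec.span (insert ?e ?H)" for w :: "'a ^ 'n"
    proof -
      \<comment> \<open>The multiple of \<open>?e\<close> has the same product with \<open>u\<close>
        as \<open>w\<close>, so subtracting it moves \<open>w\<close> into
        \<open>?H\<close>.\<close>
      have "dot u (w - (dot u w / u $ i) *s ?e) = 0"
      proof -
        have "dot u w = dot u ((w - (dot u w / u $ i) *s ?e) + (dot u w / u $ i) *s ?e)" by simp
        also have "\<dots> = dot u (w - (dot u w / u $ i) *s ?e) + dot u w"
          unfolding dot_add dot_scale[of u _ ?e] dot_axis using i by simp
        finally show ?thesis by simp
      qed
      then show ?thesis
        unfolding vec.span_breakdown_eq by (blast intro: vec.span_base)
    qed
    then have "vec.span (insert ?e ?H) = UNIV" by auto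
    then have "vec.dim (insert ?e ?H) = CARD('n)" using vec.dim_span vec_dim_card by metis
    then show ?thesis by (simp add: vec.dim_insert split: if_splits)
  qed
next
  fix u :: "'a ^ 'n" assume "\<And>w. dot u w = 0"
  then have "u $ i * 1 = 0" for i using dot_axis[of u i 1] by simp
  then show "u = 0" by (simp add: vec_eq_iff)
qed (simp add: dot_commute)

section \<open>Counting subspaces\<close>

lemma zero_in_subs: "{0} \<in> subs 0"
  by (simp add: subs_def)

lemma UNIV_in_subs: "(UNIV :: ('a::field ^ 'n) set) \<in> subs CARD('n)"
  by (simp add: subs_def vec_dim_card del: vec.dim_UNIV)

lemma zero_subset_subs: "U \<in> subs k \<Longrightarrow> {0} \<subseteq> U"
  by (simp add: subs_def vec.subspace_0)

text \<open>Dual of \<open>card_subs_covers\<close>: \<open>dot.perp\<close> reverses the interval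
  from \<open>U\<close> to \<open>V\<close>, so hyperplanes of \<open>V\<close> on \<open>U\<close>
  become covers of \<open>dot.perp V\<close>.\<close>

lemma card_subs_hyperplanes:
  fixes U V :: "('a::{field,finite} ^ 'n) set"
  assumes U: "U \<in> subs k" and V: "V \<in> subs m" and UV: "U \<subseteq> V"
    and m: "m = k + Suc j" and k': "k' = k + j"
  shows "int (card {W \<in> subs k'. U \<subseteq> W \<and> W \<subseteq> V}) = (\<Sum>i<Suc j. int CARD('a) ^ i)"
proof -
  let ?n = "CARD('n)"
  have le: "k + Suc j \<le> ?n"
    using subs_dim_le[OF V UNIV_in_subs] m by simp
  let ?A = "{W \<in> subs k'. U \<subseteq> W \<and> W \<subseteq> V}"
  let ?B = "{W \<in> subs (?n - k'). dot.perp V \<subseteq> W \<and> W \<subseteq> dot.perp U}"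
  have pp: "dot.perp (dot.perp W) = W" if "W \<in> subs i" for W :: "('a ^ 'n) set" and i
    using that by (simp add: subs_def dot.perp_perp)
  have k'': "?n - (?n - k') = k'" using le k' by simp
  have "bij_betw dot.perp ?A ?B"
  proof (rule bij_betwI[where g = dot.perp])
    show "dot.perp \<in> ?A \<rightarrow> ?B"
      using dot.perp_in_subs dot.perp_antimono by blast
    show "dot.perp \<in> ?B \<rightarrow> ?A"
    proof
      fix W assume W: "W \<in> ?B"
      have "dot.perp W \<in> subs k'" using dot.perp_in_subs[of W "?n - k'"] W k'' by simp
      moreover have "U \<subseteq> dot.perp W" "dot.perp W \<subseteq> V"
        using W dot.perp_antimono[of W "dot.perp U"] dot.perp_antimono[of "dot.perp V" W]
          pp[OF U] pp[OF V] by auto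
      ultimately show "dot.perp W \<in> ?A" by simp
    qed
  qed (use pp in blast)+
  then have "card ?A = card ?B" by (rule bij_betw_same_card)
  moreover have "int (card ?B) = (\<Sum>i<Suc j. int CARD('a) ^ i)"
    using dot.perp_in_subs[OF V] dot.perp_in_subs[OF U] dot.perp_antimono[OF UV]
    by (rule card_subs_covers) (use le m k' in auto)
  ultimately show ?thesis by simp
qed

lemma sum_weighted_swap:
  fixes g :: "'b \<Rightarrow> int"
  assumes "finite A" "finite B"
  shows "(\<Sum>a\<in>A. \<Sum>b | b \<in> B \<and> R a b. g b) = (\<Sum>b\<in>B. g b * int (card {a \<in> A. R a b}))"
proof -
  have "(\<Sum>a\<in>A. \<Sum>b | b \<in> B \<and> R a b. g b) = (\<Sum>b\<in>B. \<Sum>a | a \<in> A \<and> R a b. g b)"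
    using assms by (rule sum.swap_restrict)
  then show ?thesis by (simp add: mult.commute)
qed

lemma sum_card_swap:
  assumes "finite A" "finite B"
  shows "(\<Sum>a\<in>A. int (card {b \<in> B. R a b})) = (\<Sum>b\<in>B. int (card {a \<in> A. R a b}))"
  using sum_weighted_swap[OF assms, of "\<lambda>_. 1" R] by simp

lemma sum_if_card:
  fixes c d :: int
  assumes "finite A"
  shows "(\<Sum>a\<in>A. if R a then c else d) = d * int (card A) + (c - d) * int (card {a \<in> A. R a})"
proof -
  have "(\<Sum>a\<in>A. if R a then c else d) = (\<Sum>a\<in>A. d + (c - d) * (if R a then 1 else 0))"
    by (intro sum.cong) auto
  also have "\<dots> = d * int (card A) + (c - d) * (\<Sum>a\<in>A. if R a then 1 else 0)"
    by (simp add: sum.distrib sum_distrib_left)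
  also have "(\<Sum>a\<in>A. if R a then 1 else 0 :: int) = int (card {a \<in> A. R a})"
    using assms by (simp add: sum.If_cases Int_def)
  finally show ?thesis by simp
qed

lemma geometric_sums:
  fixes b :: int
  shows "(\<Sum>i<2. b ^ i) = b + 1" "(\<Sum>i<3. b ^ i) = b\<^sup>2 + b + 1"
    "(\<Sum>i<Suc 2. b ^ i) = b\<^sup>2 + b + 1" "(\<Sum>i<Suc 3. b ^ i) = b ^ 3 + b\<^sup>2 + b + 1"
    "(\<Sum>i<4. b ^ i) = b ^ 3 + b\<^sup>2 + b + 1" "(\<Sum>i<5. b ^ i) = b ^ 4 + b ^ 3 + b\<^sup>2 + b + 1"
  by (simp_all add: eval_nat_numeral)

text \<open>The parameter \<open>scalar_type\<close> only carries the type of scalars.\<close>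

locale projective_5_space =
  fixes q :: int and scalar_type :: "'a::{field,finite} itself"
  assumes q_def: "q = int CARD('a)" and q_ge: "q \<ge> 25"
begin

abbreviation Points :: "('a ^ 6) set set" where "Points \<equiv> subs 1"
abbreviation Lines :: "('a ^ 6) set set" where "Lines \<equiv> subs 2"
abbreviation Planes :: "('a ^ 6) set set" where "Planes \<equiv> subs 3"
abbreviation Solids :: "('a ^ 6) set set" where "Solids \<equiv> subs 4"

lemma UNIV_in_subs_6: "(UNIV :: ('a ^ 6) set) \<in> subs 6"
  using UNIV_in_subs[where ?'n = 6] by simp

section \<open>Numbers of subspaces in PG(5,q)\<close>

lemma card_points_line:
  assumes "l \<in> Lines"
  shows "int (card {P \<in> Points. P \<subseteq> l}) = q + 1"
proof -
  have "{P \<in> Points. P \<subseteq> l} = {P \<in> Points. {0} \<subseteq> P \<and> P \<subseteq> l}"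
    using zero_subset_subs by blast
  then have "int (card {P \<in> Points. P \<subseteq> l}) = int (card {P \<in> Points. {0} \<subseteq> P \<and> P \<subseteq> l})" by simp
  also have "\<dots> = (\<Sum>i<2. q ^ i)"
    unfolding q_def by (rule card_subs_covers[OF zero_in_subs assms zero_subset_subs[OF assms]]) simp_all
  finally show ?thesis by (simp only: geometric_sums)
qed

lemma card_lines_point_plane:
  assumes "P \<in> Points" "E \<in> Planes" "P \<subseteq> E"
  shows "int (card {l \<in> Lines. P \<subseteq> l \<and> l \<subseteq> E}) = q + 1"
proof -
  have "int (card {l \<in> Lines. P \<subseteq> l \<and> l \<subseteq> E}) = (\<Sum>i<2. q ^ i)"
    unfolding q_def by (rule card_subs_covers[OF assms]) simp_all
  then show ?thesis by (simp only: geometric_sums)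
qed

lemma card_planes_line_solid:
  assumes "l \<in> Lines" "S \<in> Solids" "l \<subseteq> S"
  shows "int (card {E \<in> Planes. l \<subseteq> E \<and> E \<subseteq> S}) = q + 1"
proof -
  have "int (card {E \<in> Planes. l \<subseteq> E \<and> E \<subseteq> S}) = (\<Sum>i<2. q ^ i)"
    unfolding q_def by (rule card_subs_covers[OF assms]) simp_all
  then show ?thesis by (simp only: geometric_sums)
qed

lemma card_lines_plane:
  assumes "E \<in> Planes"
  shows "int (card {l \<in> Lines. l \<subseteq> E}) = q\<^sup>2 + q + 1"
proof -
  have "{l \<in> Lines. l \<subseteq> E} = {l \<in> Lines. {0} \<subseteq> l \<and> l \<subseteq> E}"
    using zero_subset_subs by blast
  then have "int (card {l \<in> Lines. l \<subseteq> E}) = int (card {l \<in> Lines. {0} \<subseteq> l \<and> l \<subseteq> E})" by simp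
  also have "\<dots> = (\<Sum>i<Suc 2. q ^ i)"
    unfolding q_def by (rule card_subs_hyperplanes[OF zero_in_subs assms zero_subset_subs[OF assms]]) simp_all
  finally show ?thesis by (simp only: geometric_sums)
qed

lemma card_lines_point_solid:
  assumes "P \<in> Points" "S \<in> Solids" "P \<subseteq> S"
  shows "int (card {l \<in> Lines. P \<subseteq> l \<and> l \<subseteq> S}) = q\<^sup>2 + q + 1"
proof -
  have "int (card {l \<in> Lines. P \<subseteq> l \<and> l \<subseteq> S}) = (\<Sum>i<3. q ^ i)"
    unfolding q_def by (rule card_subs_covers[OF assms]) simp_all
  then show ?thesis by (simp only: geometric_sums)
qed

lemma card_planes_point_solid:
  assumes "P \<in> Points" "S \<in> Solids" "P \<subseteq> S"
  shows "int (card {E \<in> Planes. P \<subseteq> E \<and> E \<subseteq> S}) = q\<^sup>2 + q + 1"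
proof -
  have "int (card {E \<in> Planes. P \<subseteq> E \<and> E \<subseteq> S}) = (\<Sum>i<Suc 2. q ^ i)"
    unfolding q_def by (rule card_subs_hyperplanes[OF assms]) simp_all
  then show ?thesis by (simp only: geometric_sums)
qed

lemma card_solids_plane:
  assumes "E \<in> Planes"
  shows "int (card {S \<in> Solids. E \<subseteq> S}) = q\<^sup>2 + q + 1"
proof -
  have "int (card {S \<in> Solids. E \<subseteq> S \<and> S \<subseteq> UNIV}) = (\<Sum>i<3. q ^ i)"
    unfolding q_def by (rule card_subs_covers[OF assms UNIV_in_subs_6 subset_UNIV]) simp_all
  then show ?thesis by (simp only: geometric_sums subset_UNIV simp_thms)
qed

lemma card_planes_solid:
  assumes "S \<in> Solids"
  shows "int (card {E \<in> Planes. E \<subseteq> S}) = q ^ 3 + q\<^sup>2 + q + 1"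
proof -
  have "{E \<in> Planes. E \<subseteq> S} = {E \<in> Planes. {0} \<subseteq> E \<and> E \<subseteq> S}"
    using zero_subset_subs by blast
  then have "int (card {E \<in> Planes. E \<subseteq> S}) = int (card {E \<in> Planes. {0} \<subseteq> E \<and> E \<subseteq> S})" by simp
  also have "\<dots> = (\<Sum>i<Suc 3. q ^ i)"
    unfolding q_def by (rule card_subs_hyperplanes[OF zero_in_subs assms zero_subset_subs[OF assms]]) simp_all
  finally show ?thesis by (simp only: geometric_sums)
qed

lemma card_planes_line:
  assumes "l \<in> Lines"
  shows "int (card {E \<in> Planes. l \<subseteq> E}) = q ^ 3 + q\<^sup>2 + q + 1"
proof -
  have "int (card {E \<in> Planes. l \<subseteq> E \<and> E \<subseteq> UNIV}) = (\<Sum>i<4. q ^ i)"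
    unfolding q_def by (rule card_subs_covers[OF assms UNIV_in_subs_6 subset_UNIV]) simp_all
  then show ?thesis by (simp only: geometric_sums subset_UNIV simp_thms)
qed

lemma card_lines_point:
  assumes "P \<in> Points"
  shows "int (card {l \<in> Lines. P \<subseteq> l}) = q ^ 4 + q ^ 3 + q\<^sup>2 + q + 1"
proof -
  have "int (card {l \<in> Lines. P \<subseteq> l \<and> l \<subseteq> UNIV}) = (\<Sum>i<5. q ^ i)"
    unfolding q_def by (rule card_subs_covers[OF assms UNIV_in_subs_6 subset_UNIV]) simp_all
  then show ?thesis by (simp only: geometric_sums subset_UNIV simp_thms)
qed

end

section \<open>Counting identities\<close>

text \<open>Collects the self-dual part of the hypotheses, so that the locale can be interpreted for
  the dual set of planes as well.\<close>

locale regular_plane_set = projective_5_space q "TYPE('a::{field,finite})" for q +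
  fixes L :: "('a::{field,finite} ^ 6) set set"
  assumes L_planes: "L \<subseteq> subs 3"
    and card_L: "int (card L) = (q + 1)\<^sup>2 * (q\<^sup>2 + 1) * (q\<^sup>2 - q + 1)"
    and card_neighbours: "E \<in> subs 3 \<Longrightarrow>
      int (card {F \<in> L. F \<noteq> E \<and> E \<inter> F \<in> subs 2}) =
        (q + 1)\<^sup>2 + (if E \<in> L then q ^ 3 - q - 1 else 0)"
begin

definition above :: "('a ^ 6) set \<Rightarrow> int" where
  "above U = int (card {E \<in> L. U \<subseteq> E})"

definition below :: "('a ^ 6) set \<Rightarrow> int" where
  "below S = int (card {E \<in> L. E \<subseteq> S})"

definition between :: "('a ^ 6) set \<Rightarrow> ('a ^ 6) set \<Rightarrow> int" where
  "between U S = int (card {E \<in> L. U \<subseteq> E \<and> E \<subseteq> S})"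

lemma lines_in_two_planes:
  assumes "E \<in> Planes" "F \<in> Planes" "E \<noteq> F"
  shows "{l \<in> Lines. l \<subseteq> E \<and> l \<subseteq> F} = (if E \<inter> F \<in> Lines then {E \<inter> F} else {})"
proof -
  have "l = E \<inter> F" if l: "l \<in> Lines" "l \<subseteq> E" "l \<subseteq> F" for l
  proof -
    obtain k where k: "E \<inter> F \<in> subs k" "k \<le> 3" using subs_Int_join[OF assms(1,2)] by auto
    have "k \<noteq> 3"
    proof
      assume "k = 3"
      then have "E \<inter> F \<in> Planes" using k by simp
      then have "E \<inter> F = E" "E \<inter> F = F" using assms subs_eqI by blast+
      then show False using assms by simp
    qed
    moreover have "2 \<le> k" using subs_dim_le[OF l(1) k(1)] l by simp
    ultimately have "k = 2" using k(2) by simp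
    then have "E \<inter> F \<in> Lines" using k(1) by simp
    then show ?thesis using subs_eqI[OF l(1)] l by simp
  qed
  then have "{l \<in> Lines. l \<subseteq> E \<and> l \<subseteq> F} = {l \<in> Lines. l = E \<inter> F}" by blast
  then show ?thesis by (simp add: Collect_conv_if)
qed

text \<open>Counts pairs of a line of \<open>E\<close> and a plane of \<open>L\<close> on it:
  \<open>E\<close>, if in \<open>L\<close>, contributes all its lines, each neighbour one, every
  other plane none. In this form the neighbour hypothesis enters all later counts.\<close>

lemma sum_above_plane:
  assumes E: "E \<in> Planes"
  shows "(\<Sum>l | l \<in> Lines \<and> l \<subseteq> E. above l) = (q + 1)\<^sup>2 + (if E \<in> L then q ^ 3 + q\<^sup>2 else 0)"
proof -
  have "(\<Sum>l | l \<in> Lines \<and> l \<subseteq> E. above l) = (\<Sum>F\<in>L. int (card {l \<in> {l \<in> Lines. l \<subseteq> E}. l \<subseteq> F}))"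
    unfolding above_def by (rule sum_card_swap) auto
  also have "\<dots> = (\<Sum>F\<in>L. (if F = E then q\<^sup>2 + q + 1 else 0) + (if F \<noteq> E \<and> E \<inter> F \<in> Lines then 1 else 0))"
  proof (rule sum.cong[OF refl])
    fix F assume F: "F \<in> L"
    show "int (card {l \<in> {l \<in> Lines. l \<subseteq> E}. l \<subseteq> F}) =
      (if F = E then q\<^sup>2 + q + 1 else 0) + (if F \<noteq> E \<and> E \<inter> F \<in> Lines then 1 else 0)"
    proof (cases "F = E")
      case True
      then have "{l \<in> {l \<in> Lines. l \<subseteq> E}. l \<subseteq> F} = {l \<in> Lines. l \<subseteq> E}" by auto
      then show ?thesis using True card_lines_plane[OF E] by simp
    next
      case False
      have "{l \<in> {l \<in> Lines. l \<subseteq> E}. l \<subseteq> F} = {l \<in> Lines. l \<subseteq> E \<and> l \<subseteq> F}" by auto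
      then show ?thesis
        using False lines_in_two_planes[OF E, of F] F L_planes by (simp add: subset_iff)
    qed
  qed
  also have "\<dots> = (if E \<in> L then q\<^sup>2 + q + 1 else 0) + int (card {F \<in> L. F \<noteq> E \<and> E \<inter> F \<in> Lines})"
    by (simp add: sum.distrib sum_if_card)
  also have "\<dots> = (q + 1)\<^sup>2 + (if E \<in> L then q ^ 3 + q\<^sup>2 else 0)"
    using card_neighbours[OF E] by simp
  finally show ?thesis .
qed

lemma sum_above_lines: "(\<Sum>l\<in>Lines. above l) = (q\<^sup>2 + q + 1) * int (card L)"
proof -
  have "(\<Sum>l\<in>Lines. above l) = (\<Sum>E\<in>L. int (card {l \<in> Lines. l \<subseteq> E}))"
    unfolding above_def by (rule sum_card_swap) auto
  also have "\<dots> = (\<Sum>E\<in>L. q\<^sup>2 + q + 1)"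
    using L_planes card_lines_plane by (intro sum.cong) auto
  finally show ?thesis by simp
qed

lemma sum_above_lines_point:
  assumes "P \<in> Points"
  shows "(\<Sum>l | l \<in> Lines \<and> P \<subseteq> l. above l) = (q + 1) * above P"
proof -
  have "(\<Sum>l | l \<in> Lines \<and> P \<subseteq> l. above l) = (\<Sum>E\<in>L. int (card {l \<in> {l \<in> Lines. P \<subseteq> l}. l \<subseteq> E}))"
    unfolding above_def by (rule sum_card_swap) auto
  also have "\<dots> = (\<Sum>E\<in>L. if P \<subseteq> E then q + 1 else 0)"
  proof (rule sum.cong[OF refl])
    fix E assume "E \<in> L"
    show "int (card {l \<in> {l \<in> Lines. P \<subseteq> l}. l \<subseteq> E}) = (if P \<subseteq> E then q + 1 else 0)"
    proof (cases "P \<subseteq> E")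
      case True
      then show ?thesis
        using card_lines_point_plane[OF assms, of E] \<open>E \<in> L\<close> L_planes by auto
    next
      case False
      then have "{l \<in> {l \<in> Lines. P \<subseteq> l}. l \<subseteq> E} = {}" by auto
      then show ?thesis using False by simp
    qed
  qed
  finally show ?thesis by (simp add: sum_if_card above_def)
qed

lemma join_point_line:
  assumes "P \<in> Points" "l \<in> Lines" "\<not> P \<subseteq> l"
  shows "join P l \<in> Planes"
proof -
  obtain k where k: "P \<inter> l \<in> subs k" "k \<le> 1" "join P l \<in> subs (1 + 2 - k)"
    using subs_Int_join[OF assms(1,2)] by auto
  have "k \<noteq> 1" using subs_eqI[of "P \<inter> l" 1 P] k assms by auto
  then have "k = 0" using k by simp
  then show ?thesis using k by (simp add: numeral_3_eq_3)
qed

lemma card_planes_point_line: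
  assumes "P \<in> Points" "l \<in> Lines" "\<not> P \<subseteq> l"
  shows "{E \<in> Planes. P \<subseteq> E \<and> l \<subseteq> E} = {join P l}"
proof -
  have "E = join P l" if "E \<in> Planes" "P \<subseteq> E" "l \<subseteq> E" for E
  proof -
    have "join P l \<subseteq> E" using that subs_subspace[OF that(1)] by (intro join_least)
    then show ?thesis using subs_eqI[OF join_point_line[OF assms] that(1)] by simp
  qed
  then have "{E \<in> Planes. P \<subseteq> E \<and> l \<subseteq> E} \<subseteq> {join P l}" by blast
  moreover have "{join P l} \<subseteq> {E \<in> Planes. P \<subseteq> E \<and> l \<subseteq> E}"
    using join_point_line[OF assms] join_upper1[of P l] join_upper2[of l P] by simp
  ultimately show ?thesis by (rule subset_antisym)
qed

text \<open>Sum \<open>sum_above_plane\<close> over all planes on \<open>P\<close>. A line on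
  \<open>P\<close> occurs \<open>G\<close> times and any other line once, so both sides are linear
  in \<open>above P\<close> and the equation can be solved.\<close>

lemma above_point:
  assumes P: "P \<in> Points"
  shows "above P = (q + 1) * (q\<^sup>2 + 1)"
proof -
  let ?EP = "{E \<in> Planes. P \<subseteq> E}"
  define G where "G = q ^ 3 + q\<^sup>2 + q + 1"
  have fin: "finite ?EP" "finite Lines" by auto
  \<comment> \<open>\<open>one\<close> and \<open>two\<close> count the incident line-plane pairs on
    \<open>P\<close> in both orders, which gives the number of planes on \<open>P\<close>.\<close>
  have one: "(\<Sum>E\<in>?EP. int (card {l \<in> {l \<in> Lines. P \<subseteq> l}. l \<subseteq> E})) = (q + 1) * int (card ?EP)"
  proof -
    have "(\<Sum>E\<in>?EP. int (card {l \<in> {l \<in> Lines. P \<subseteq> l}. l \<subseteq> E})) = (\<Sum>E\<in>?EP. q + 1)"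
      using card_lines_point_plane[OF P] by (intro sum.cong) auto
    then show ?thesis by simp
  qed
  have two: "(\<Sum>E\<in>?EP. int (card {l \<in> {l \<in> Lines. P \<subseteq> l}. l \<subseteq> E})) = G * (q ^ 4 + q ^ 3 + q\<^sup>2 + q + 1)"
  proof -
    have "(\<Sum>E\<in>?EP. int (card {l \<in> {l \<in> Lines. P \<subseteq> l}. l \<subseteq> E})) =
        (\<Sum>l | l \<in> Lines \<and> P \<subseteq> l. int (card {E \<in> ?EP. l \<subseteq> E}))"
      by (rule sum_card_swap) auto
    also have "\<dots> = (\<Sum>l | l \<in> Lines \<and> P \<subseteq> l. G)"
    proof (rule sum.cong[OF refl])
      fix l assume l: "l \<in> {l \<in> Lines. P \<subseteq> l}"
      then have "{E \<in> ?EP. l \<subseteq> E} = {E \<in> Planes. l \<subseteq> E}" by auto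
      then show "int (card {E \<in> ?EP. l \<subseteq> E}) = G"
        using card_planes_line l by (simp add: G_def)
    qed
    finally show ?thesis using card_lines_point[OF P] by (simp add: mult.commute)
  qed
  have "(q + 1) * int (card ?EP) = (q + 1) * ((q\<^sup>2 + 1) * (q ^ 4 + q ^ 3 + q\<^sup>2 + q + 1))"
    unfolding one[symmetric] two G_def by algebra
  then have card_EP: "int (card ?EP) = (q\<^sup>2 + 1) * (q ^ 4 + q ^ 3 + q\<^sup>2 + q + 1)"
    using q_ge by (subst (asm) mult_cancel_left) auto
  have "(\<Sum>E\<in>?EP. \<Sum>l | l \<in> Lines \<and> l \<subseteq> E. above l) =
      (\<Sum>l\<in>Lines. above l * int (card {E \<in> ?EP. l \<subseteq> E}))"
    using fin by (rule sum_weighted_swap)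
  also have "\<dots> = (\<Sum>l\<in>Lines. above l + (if P \<subseteq> l then (G - 1) * above l else 0))"
  proof (rule sum.cong[OF refl])
    fix l assume l: "l \<in> Lines"
    show "above l * int (card {E \<in> ?EP. l \<subseteq> E}) = above l + (if P \<subseteq> l then (G - 1) * above l else 0)"
    proof (cases "P \<subseteq> l")
      case True
      then have "{E \<in> ?EP. l \<subseteq> E} = {E \<in> Planes. l \<subseteq> E}" by auto
      then show ?thesis using True card_planes_line[OF l] by (simp add: G_def algebra_simps)
    next
      case False
      then have "{E \<in> ?EP. l \<subseteq> E} = {join P l}" using card_planes_point_line[OF P l] by auto
      then show ?thesis using False by simp
    qed
  qed
  also have "\<dots> = (q\<^sup>2 + q + 1) * int (card L) + (G - 1) * ((q + 1) * above P)"
    using sum_above_lines_point[OF P]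
    by (simp add: sum.distrib sum_above_lines sum.If_cases Int_def sum_distrib_left[symmetric])
  finally have lhs: "(\<Sum>E\<in>?EP. \<Sum>l | l \<in> Lines \<and> l \<subseteq> E. above l) =
      (q\<^sup>2 + q + 1) * int (card L) + (G - 1) * ((q + 1) * above P)" .
  have "(\<Sum>E\<in>?EP. \<Sum>l | l \<in> Lines \<and> l \<subseteq> E. above l) =
      (\<Sum>E\<in>?EP. (q + 1)\<^sup>2 + (if E \<in> L then q ^ 3 + q\<^sup>2 else 0))"
    using sum_above_plane by (intro sum.cong) auto
  also have "\<dots> = (q + 1)\<^sup>2 * int (card ?EP) + (q ^ 3 + q\<^sup>2) * int (card {E \<in> ?EP. E \<in> L})"
    by (simp add: sum.distrib sum_if_card)
  also have "{E \<in> ?EP. E \<in> L} = {E \<in> L. P \<subseteq> E}" using L_planes by auto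
  finally have rhs: "(\<Sum>E\<in>?EP. \<Sum>l | l \<in> Lines \<and> l \<subseteq> E. above l) =
      (q + 1)\<^sup>2 * int (card ?EP) + (q ^ 3 + q\<^sup>2) * above P"
    by (simp add: above_def)
  \<comment> \<open>The coefficient is \<open>(G - 1) * (q + 1) - (q ^ 3 + q ^ 2)\<close>, the
    difference of those in \<open>lhs\<close> and \<open>rhs\<close>.\<close>
  have "(q * (q + 1) * (q\<^sup>2 + 1)) * above P = (q * (q + 1) * (q\<^sup>2 + 1)) * ((q + 1) * (q\<^sup>2 + 1))"
    using lhs rhs unfolding card_EP card_L G_def by algebra
  moreover have "q * (q + 1) * (q\<^sup>2 + 1) > 0"
    using q_ge by (intro mult_pos_pos add_nonneg_pos) auto
  ultimately show ?thesis by (subst (asm) mult_cancel_left) auto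
qed

lemma between_nonneg: "between U S \<ge> 0"
  by (simp add: between_def)

lemma between_le_above: "between U S \<le> above U" and between_le_below: "between U S \<le> below S"
  unfolding between_def above_def below_def by (auto intro!: card_mono)

lemma below_eq_card_planes: "below S = int (card {E \<in> {E \<in> Planes. E \<subseteq> S}. E \<in> L})"
  using L_planes unfolding below_def by (auto intro!: arg_cong[where f = card])

lemma sum_above_lines_solid:
  assumes S: "S \<in> Solids"
  shows "(\<Sum>l | l \<in> Lines \<and> l \<subseteq> S. above l) = (q + 1)\<^sup>2 * (q\<^sup>2 + 1) + q\<^sup>2 * below S"
proof -
  let ?ES = "{E \<in> Planes. E \<subseteq> S}" and ?lS = "{l \<in> Lines. l \<subseteq> S}"
  have fin: "finite ?ES" "finite ?lS" by auto
  have "(\<Sum>E\<in>?ES. \<Sum>l | l \<in> ?lS \<and> l \<subseteq> E. above l) =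
      (\<Sum>l\<in>?lS. above l * int (card {E \<in> ?ES. l \<subseteq> E}))"
    using fin by (rule sum_weighted_swap)
  also have "\<dots> = (\<Sum>l\<in>?lS. above l * (q + 1))"
  proof (rule sum.cong[OF refl])
    fix l assume l: "l \<in> ?lS"
    have "{E \<in> ?ES. l \<subseteq> E} = {E \<in> Planes. l \<subseteq> E \<and> E \<subseteq> S}" by auto
    then show "above l * int (card {E \<in> ?ES. l \<subseteq> E}) = above l * (q + 1)"
      using card_planes_line_solid[OF _ S, of l] l by simp
  qed
  finally have lhs: "(\<Sum>E\<in>?ES. \<Sum>l | l \<in> ?lS \<and> l \<subseteq> E. above l) = (q + 1) * (\<Sum>l\<in>?lS. above l)"
    by (simp add: sum_distrib_left mult.commute)
  have "(\<Sum>E\<in>?ES. \<Sum>l | l \<in> ?lS \<and> l \<subseteq> E. above l) =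
      (\<Sum>E\<in>?ES. (q + 1)\<^sup>2 + (if E \<in> L then q ^ 3 + q\<^sup>2 else 0))"
  proof (rule sum.cong[OF refl])
    fix E assume E: "E \<in> ?ES"
    then have "{l. l \<in> ?lS \<and> l \<subseteq> E} = {l. l \<in> Lines \<and> l \<subseteq> E}" by auto
    then show "(\<Sum>l | l \<in> ?lS \<and> l \<subseteq> E. above l) = (q + 1)\<^sup>2 + (if E \<in> L then q ^ 3 + q\<^sup>2 else 0)"
      using sum_above_plane[of E] E by simp
  qed
  also have "\<dots> = (q + 1)\<^sup>2 * (q ^ 3 + q\<^sup>2 + q + 1) + (q ^ 3 + q\<^sup>2) * below S"
    using card_planes_solid[OF S] by (simp add: sum.distrib sum_if_card below_eq_card_planes)
  finally have "(q + 1) * (\<Sum>l\<in>?lS. above l) = (q + 1) * ((q + 1)\<^sup>2 * (q\<^sup>2 + 1) + q\<^sup>2 * below S)"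
    unfolding lhs by algebra
  then show ?thesis using q_ge by simp
qed

text \<open>Sum \<open>sum_above_plane\<close> over the planes of \<open>S\<close> on
  \<open>P\<close>. A line of \<open>S\<close> on \<open>P\<close> occurs \<open>q + 1\<close> times
  and any other line once, in its join with \<open>P\<close>; what remains after removing one copy
  of each line of \<open>S\<close> is \<open>q\<close> times the wanted sum.\<close>

lemma sum_above_lines_point_solid:
  assumes P: "P \<in> Points" and S: "S \<in> Solids" and PS: "P \<subseteq> S"
  shows "(\<Sum>l | l \<in> Lines \<and> P \<subseteq> l \<and> l \<subseteq> S. above l) =
    (q + 1)\<^sup>2 + q * (q + 1) * between P S - q * below S"
proof -
  let ?ES = "{E \<in> Planes. P \<subseteq> E \<and> E \<subseteq> S}" and ?lS = "{l \<in> Lines. l \<subseteq> S}"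
  have fin: "finite ?ES" "finite ?lS" by auto
  have subsp: "vec.subspace S" using S by (simp add: subs_def)
  have "(\<Sum>E\<in>?ES. \<Sum>l | l \<in> ?lS \<and> l \<subseteq> E. above l) =
      (\<Sum>l\<in>?lS. above l * int (card {E \<in> ?ES. l \<subseteq> E}))"
    using fin by (rule sum_weighted_swap)
  also have "\<dots> = (\<Sum>l\<in>?lS. above l + (if P \<subseteq> l then q * above l else 0))"
  proof (rule sum.cong[OF refl])
    fix l assume l: "l \<in> ?lS"
    show "above l * int (card {E \<in> ?ES. l \<subseteq> E}) = above l + (if P \<subseteq> l then q * above l else 0)"
    proof (cases "P \<subseteq> l")
      case True
      then have "{E \<in> ?ES. l \<subseteq> E} = {E \<in> Planes. l \<subseteq> E \<and> E \<subseteq> S}" by auto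
      then show ?thesis using True card_planes_line_solid[OF _ S, of l] l by (simp add: algebra_simps)
    next
      case False
      have "join P l \<subseteq> S" using join_least[OF subsp PS] l by auto
      then have "{E \<in> ?ES. l \<subseteq> E} = {join P l}"
        using card_planes_point_line[OF P _ False] l by auto
      then show ?thesis using False by simp
    qed
  qed
  also have "\<dots> = (\<Sum>l\<in>?lS. above l) + q * (\<Sum>l | l \<in> Lines \<and> P \<subseteq> l \<and> l \<subseteq> S. above l)"
  proof -
    have "?lS \<inter> {l. P \<subseteq> l} = {l \<in> Lines. P \<subseteq> l \<and> l \<subseteq> S}" by auto
    then show ?thesis by (simp add: sum.distrib sum.If_cases sum_distrib_left)
  qed
  finally have lhs: "(\<Sum>E\<in>?ES. \<Sum>l | l \<in> ?lS \<and> l \<subseteq> E. above l) =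
      (\<Sum>l\<in>?lS. above l) + q * (\<Sum>l | l \<in> Lines \<and> P \<subseteq> l \<and> l \<subseteq> S. above l)" .
  have "(\<Sum>E\<in>?ES. \<Sum>l | l \<in> ?lS \<and> l \<subseteq> E. above l) =
      (\<Sum>E\<in>?ES. (q + 1)\<^sup>2 + (if E \<in> L then q ^ 3 + q\<^sup>2 else 0))"
  proof (rule sum.cong[OF refl])
    fix E assume E: "E \<in> ?ES"
    then have "{l. l \<in> ?lS \<and> l \<subseteq> E} = {l. l \<in> Lines \<and> l \<subseteq> E}" by auto
    then show "(\<Sum>l | l \<in> ?lS \<and> l \<subseteq> E. above l) = (q + 1)\<^sup>2 + (if E \<in> L then q ^ 3 + q\<^sup>2 else 0)"
      using sum_above_plane[of E] E by simp
  qed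
  also have "\<dots> = (q + 1)\<^sup>2 * (q\<^sup>2 + q + 1) + (q ^ 3 + q\<^sup>2) * between P S"
  proof -
    have "{E \<in> ?ES. E \<in> L} = {E \<in> L. P \<subseteq> E \<and> E \<subseteq> S}" using L_planes by auto
    then show ?thesis
      using card_planes_point_solid[OF P S PS] by (simp add: sum.distrib sum_if_card between_def)
  qed
  finally have "q * (\<Sum>l | l \<in> Lines \<and> P \<subseteq> l \<and> l \<subseteq> S. above l) =
      q * ((q + 1)\<^sup>2 + q * (q + 1) * between P S - q * below S)"
    unfolding lhs using sum_above_lines_solid[OF S] by algebra
  then show ?thesis using q_ge by simp
qed

end

section \<open>Solids with many planes\<close>

text \<open>The next two lemmas are the arithmetic of the bound on \<open>K\<close>: there \<open>Q\<close>, \<open>W\<close>, \<open>D\<close> are the sums of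
  \<open>e t\<^sup>2\<close>, \<open>e t\<close>, \<open>e\<close> over the lines of the solid, and \<open>f\<close> is the number of lines with \<open>t = q + 1\<close>.\<close>

lemma weighted_count_contradiction_light:
  fixes q K N Q W D :: int
  assumes q: "q \<ge> 25" and K: "K > q + 1" "2 * K \<le> (q + 1)\<^sup>2"
    and N: "N = q ^ 3 + q\<^sup>2 + q + 1 - K" and W: "W = K * N" and D: "D = (q + 1) * N"
    and upper: "Q - W \<le> (K - 2) * (K * (K - 1))"
    and lower1: "Q - 3 * W + 2 * D \<ge> 0"
    and lower2: "(q + 1)\<^sup>2 * Q - 2 * K * (q + 1) * W + K\<^sup>2 * D \<ge> 0"
  shows False
proof -
  define j where "j = K - q - 1"
  have j1: "j \<ge> 1" and Kj: "K = q + 1 + j" using K by (auto simp: j_def)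
  have q25: "q * q \<ge> 25 * q" using q by (intro mult_right_mono) auto
  show False
  \<comment> \<open>For \<open>j = 1\<close>, \<open>lower2\<close> only leads to
    \<open>N <= (q + 1)^2 * q\<close>, which is consistent; \<open>lower1\<close> is needed
    instead.\<close>
  proof (cases "j = 1")
    case True
    then have K2: "K = q + 2" using Kj by simp
    have "2 * W - 2 * D \<le> (K - 2) * (K * (K - 1))" using upper lower1 by simp
    then have "2 * (q ^ 3 + q\<^sup>2 - 1) \<le> q * ((q + 2) * (q + 1))"
      unfolding W D N K2 by (simp add: algebra_simps power2_eq_square power3_eq_cube)
    then have "q * (q * q) \<le> q * q + 2 * q + 2"
      by (simp add: algebra_simps power2_eq_square power3_eq_cube)
    moreover have "q * (q * q) \<ge> 25 * (q * q)" using q by (intro mult_right_mono) auto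
    ultimately show False using q25 q by linarith
  next
    case False
    then have j2: "j \<ge> 2" using j1 by simp
    \<comment> \<open>Since \<open>W / D = K / (q + 1)\<close>, the quadratic expression collapses
      to one factor linear in \<open>Q\<close>.\<close>
    have "(q + 1)\<^sup>2 * Q - 2 * K * (q + 1) * W + K\<^sup>2 * D = (q + 1) * ((q + 1) * Q - K\<^sup>2 * N)"
      unfolding W D by (simp add: algebra_simps power2_eq_square)
    then have "(q + 1) * Q - K\<^sup>2 * N \<ge> 0" using lower2 q by (simp add: zero_le_mult_iff)
    moreover have "(q + 1) * Q \<le> (q + 1) * (W + (K - 2) * (K * (K - 1)))"
      using upper q by (intro mult_left_mono) auto
    ultimately have "K\<^sup>2 * N \<le> (q + 1) * (W + (K - 2) * (K * (K - 1)))" by linarith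
    then have "K * (N * j) \<le> K * ((q + 1) * ((q + j) * (q + j - 1)))"
      unfolding W by (simp add: j_def algebra_simps power2_eq_square)
    then have main: "N * j \<le> (q + 1) * ((q + j) * (q + j - 1))"
      using K q by simp
    have N2: "2 * N \<ge> 2 * (q * (q * q))"
    proof -
      have "2 * N \<ge> 2 * (q ^ 3 + q\<^sup>2 + q + 1) - (q + 1)\<^sup>2" using K N by simp
      moreover have "2 * (q ^ 3 + q\<^sup>2 + q + 1) - (q + 1)\<^sup>2 = 2 * (q * (q * q)) + q * q + 1"
        by (simp add: algebra_simps power2_eq_square power3_eq_cube)
      moreover have "q * q \<ge> 0" by simp
      ultimately show ?thesis by linarith
    qed
    have Nj: "N * j \<ge> (q * (q * q)) * j" using N2 j2 by (intro mult_right_mono) auto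
    have expand: "(q + 1) * ((q + j) * (q + j - 1)) =
        q * (q * q) - q + 2 * (j * (q * q)) + 2 * (j * q) + (q + 1) * (j * (j - 1))"
      by (simp add: algebra_simps)
    show False
    \<comment> \<open>The left side is about \<open>j * q^3\<close>. For \<open>j <= q\<close> the
      isolated \<open>q^3\<close> in \<open>expand\<close> is at most half of that because
      \<open>j >= 2\<close>, and the rest has lower order. For \<open>j > q\<close> it is at most
      \<open>j * q^2\<close>, while \<open>2 * K <= (q + 1)^2\<close> keeps the term quadratic in
      \<open>j\<close> near half of the left side.\<close>
    proof (cases "j \<le> q")
      case True
      have "(q + 1) * (j * (j - 1)) \<le> (q + 1) * (j * q)"
        using True j2 q by (intro mult_left_mono) auto
      then have "(q * (q * q)) * j \<le> q * (q * q) + 3 * (j * (q * q)) + 3 * (j * q)"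
        using main Nj q unfolding expand by (simp add: algebra_simps)
      moreover have "j * (25 * (q * q)) \<le> j * (q * (q * q))"
        using q j2 by (intro mult_left_mono mult_right_mono) auto
      moreover have "j * (25 * q) \<le> j * (q * q)" using q25 j2 by (intro mult_left_mono) auto
      moreover have "2 * (q * (q * q)) \<le> j * (q * (q * q))"
        using q j2 by (intro mult_right_mono) auto
      moreover have "j * (q * q) > 0" using q j2 by simp
      ultimately show False by (simp add: algebra_simps)
    next
      case False
      have "2 * (j - 1) \<le> q * q - 1" using K Kj by (simp add: algebra_simps power2_eq_square)
      then have **: "((q + 1) * j) * (2 * (j - 1)) \<le> ((q + 1) * j) * (q * q - 1)"
        using j2 q by (intro mult_left_mono) auto
      have 1: "2 * ((q + 1) * (j * (j - 1))) \<le> j * (q * (q * q)) + j * (q * q)"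
      proof -
        have "j * q \<ge> 0" using j2 q by simp
        then show ?thesis using ** j2
          by (simp add: algebra_simps)
      qed
      have 2: "q * (q * q) \<le> j * (q * q)" using False q by (intro mult_right_mono) auto
      have 3: "j * (25 * (q * q)) \<le> j * (q * (q * q))"
        using q j2 by (intro mult_left_mono mult_right_mono) auto
      have 4: "j * (25 * q) \<le> j * (q * q)" using q25 j2 by (intro mult_left_mono) auto
      have 5: "j * (q * q) > 0" using q j2 by simp
      show False using main Nj 1 2 3 4 5 q unfolding expand by (simp add: algebra_simps)
    qed
  qed
qed

lemma weighted_count_contradiction_heavy:
  fixes q K N Q W D f :: int
  assumes q: "q \<ge> 25" and K: "K \<le> (q + 1)\<^sup>2" "(q + 1)\<^sup>2 < 2 * K"
    and N: "N = q ^ 3 + q\<^sup>2 + q + 1 - K" and W: "W = K * N" and D: "D = (q + 1) * N"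
    and upper: "Q - W \<le> ((q + 1)\<^sup>2 - K) * (K * (K - 1)) + f * ((K - q - 1) * (q * (q + 1)))"
    and f: "(q + 1) * f \<le> 2 * K"
    and lower: "(q + 1)\<^sup>2 * Q - 2 * K * (q + 1) * W + K\<^sup>2 * D \<ge> 0"
  shows False
proof -
  define j where "j = K - q - 1"
  have q25: "q * q \<ge> 25 * q" using q by (intro mult_right_mono) auto
  have jb: "2 * j \<ge> q * q - 1" using K by (simp add: j_def algebra_simps power2_eq_square)
  then have j0: "j > 0" using q q25 by linarith
  then have K0: "K > 0" using q by (simp add: j_def)
  have "(q + 1)\<^sup>2 * Q - 2 * K * (q + 1) * W + K\<^sup>2 * D = (q + 1) * ((q + 1) * Q - K\<^sup>2 * N)"
    unfolding W D by (simp add: algebra_simps power2_eq_square)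
  then have "(q + 1) * Q - K\<^sup>2 * N \<ge> 0" using lower q by (simp add: zero_le_mult_iff)
  moreover have "(q + 1) * (Q - W) \<le> (q + 1) * (((q + 1)\<^sup>2 - K) * (K * (K - 1)) + f * (j * (q * (q + 1))))"
    using upper q by (intro mult_left_mono) (auto simp: j_def)
  moreover have "((q + 1) * f) * (j * (q * (q + 1))) \<le> (2 * K) * (j * (q * (q + 1)))"
    using f j0 q by (intro mult_right_mono) auto
  ultimately have "K\<^sup>2 * N \<le> (q + 1) * W + (q + 1) * (((q + 1)\<^sup>2 - K) * (K * (K - 1)))
      + (2 * K) * (j * (q * (q + 1)))"
    by (simp add: algebra_simps)
  then have "K * (N * j) \<le> K * ((q + 1) * (((q + 1)\<^sup>2 - K) * (K - 1)) + 2 * (j * (q * (q + 1))))"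
    unfolding W j_def by (simp add: algebra_simps power2_eq_square)
  then have main: "N * j \<le> (q + 1) * (((q + 1)\<^sup>2 - K) * (K - 1)) + 2 * (j * (q * (q + 1)))"
    using K0 by simp
  have "N \<ge> q * (q * q) - q"
    using K N by (simp add: algebra_simps power2_eq_square power3_eq_cube)
  then have 1: "(q * (q * q) - q) * j \<le> N * j" using j0 by (intro mult_right_mono) auto
  \<comment> \<open>In the heavy case \<open>(q + 1)^2 - K\<close> is less than half of
    \<open>(q + 1)^2\<close>, so its contribution is only about half of the left side of
    \<open>main\<close>.\<close>
  have "(q + 1) * ((2 * ((q + 1)\<^sup>2 - K)) * (K - 1)) \<le> (q + 1) * ((q + 1)\<^sup>2 * (K - 1))"
    using K K0 q by (intro mult_left_mono mult_right_mono) auto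
  also have "\<dots> = (q + 1) ^ 3 * j + (q + 1) ^ 3 * q"
    by (simp add: j_def algebra_simps power2_eq_square power3_eq_cube)
  finally have 2: "2 * ((q + 1) * (((q + 1)\<^sup>2 - K) * (K - 1))) \<le> (q + 1) ^ 3 * j + (q + 1) ^ 3 * q"
    by (simp add: algebra_simps)
  \<comment> \<open>Twice \<open>main\<close> with \<open>1\<close> and \<open>2\<close>; the
    coefficient of \<open>j\<close> is
    \<open>2 * (q^3 - q) - (q + 1)^3 - 4 * q * (q + 1)\<close>.\<close>
  have c: "(q * (q * q) - 7 * (q * q) - 9 * q - 1) * j \<le> (q + 1) ^ 3 * q"
    using main 1 2 by (simp add: algebra_simps power3_eq_cube)
  \<comment> \<open>The constant 17 has to exceed 16, which arises below as \<open>2 * 2^3\<close>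
    from \<open>q + 1 <= 2 * q\<close>; \<open>q >= 25\<close> leaves enough room.\<close>
  have "17 * (q * q) \<le> q * (q * q) - 7 * (q * q) - 9 * q - 1"
  proof -
    have "25 * (q * q) \<le> q * (q * q)" using q by (intro mult_right_mono) auto
    then show ?thesis using q25 q by linarith
  qed
  then have "(17 * (q * q)) * j \<le> (q + 1) ^ 3 * q"
    using c j0 by (meson mult_right_mono order_less_imp_le order_trans)
  moreover have "(17 * (q * q)) * (q * q - 1) \<le> (17 * (q * q)) * (2 * j)"
    using jb q by (intro mult_left_mono) auto
  ultimately have fin: "17 * (q * q) * (q * q - 1) \<le> 2 * ((q + 1) ^ 3 * q)" by linarith
  have "(q + 1) ^ 3 \<le> (2 * q) ^ 3" using q by (intro power_mono) auto
  then have "2 * ((q + 1) ^ 3 * q) \<le> 2 * ((2 * q) ^ 3 * q)"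
    using q by (intro mult_left_mono mult_right_mono) auto
  then have "17 * (q * q) * (q * q - 1) \<le> 16 * ((q * q) * (q * q))"
    using fin by (simp add: power3_eq_cube algebra_simps)
  then have "(q * q) * (q * q) \<le> 17 * (q * q)" by (simp add: algebra_simps)
  then show False using q25 q by (simp add: mult_le_cancel_right)
qed

section \<open>Incidences inside planes and solids\<close>

lemma (in projective_5_space) planes_in_solid_meet:
  assumes "E \<in> Planes" "F \<in> Planes" "E \<noteq> F" "S \<in> Solids" "E \<subseteq> S" "F \<subseteq> S"
  shows "E \<inter> F \<in> Lines"
proof -
  obtain k where k: "E \<inter> F \<in> subs k" "k \<le> 3" "join E F \<in> subs (3 + 3 - k)"
    using subs_Int_join[OF assms(1,2)] by auto
  have "k \<noteq> 3"
  proof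
    assume "k = 3"
    then have "E \<inter> F \<in> Planes" using k by simp
    then have "E \<inter> F = E" "E \<inter> F = F" using assms subs_eqI by blast+
    then show False using assms by simp
  qed
  moreover have "join E F \<subseteq> S"
    using subs_subspace[OF assms(4)] assms(5,6) by (rule join_least)
  then have "3 + 3 - k \<le> 4" using subs_dim_le[OF k(3) assms(4)] by simp
  ultimately have "k = 2" using k(2) by simp
  then show ?thesis using k(1) by simp
qed

lemma (in projective_5_space) lines_in_plane_meet:
  assumes "l \<in> Lines" "m \<in> Lines" "l \<noteq> m" "E \<in> Planes" "l \<subseteq> E" "m \<subseteq> E"
  shows "l \<inter> m \<in> Points"
proof -
  obtain k where k: "l \<inter> m \<in> subs k" "k \<le> 2" "join l m \<in> subs (2 + 2 - k)"
    using subs_Int_join[OF assms(1,2)] by auto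
  have "k \<noteq> 2"
  proof
    assume "k = 2"
    then have "l \<inter> m \<in> Lines" using k by simp
    then have "l \<inter> m = l" "l \<inter> m = m" using assms subs_eqI by blast+
    then show False using assms by simp
  qed
  moreover have "join l m \<subseteq> E"
    using subs_subspace[OF assms(4)] assms(5,6) by (rule join_least)
  then have "2 + 2 - k \<le> 3" using subs_dim_le[OF k(3) assms(4)] by simp
  ultimately have "k = 1" using k(2) by simp
  then show ?thesis using k(1) by simp
qed

lemma (in projective_5_space) card_common_planes_le_1:
  assumes "l \<in> Lines" "m \<in> Lines" "l \<noteq> m"
  shows "card {E \<in> Planes. l \<subseteq> E \<and> m \<subseteq> E} \<le> 1"
proof -
  have "E = F" if EF: "E \<in> Planes" "l \<subseteq> E" "m \<subseteq> E" "F \<in> Planes" "l \<subseteq> F" "m \<subseteq> F" for E F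
  proof (rule ccontr)
    assume "E \<noteq> F"
    obtain k where k: "E \<inter> F \<in> subs k" "k \<le> 3" using subs_Int_join[OF EF(1,4)] by auto
    have "k \<noteq> 3"
    proof
      assume "k = 3"
      then have "E \<inter> F \<in> Planes" using k by simp
      then have "E \<inter> F = E" "E \<inter> F = F" using EF subs_eqI by blast+
      then show False using \<open>E \<noteq> F\<close> by simp
    qed
    moreover have "2 \<le> k" using subs_dim_le[OF assms(1) k(1)] EF by simp
    ultimately have "E \<inter> F \<in> Lines" using k by (metis One_nat_def Suc_1 le_antisym le_SucE numeral_3_eq_3)
    then have "l = E \<inter> F" "m = E \<inter> F"
      using subs_eqI[OF assms(1)] subs_eqI[OF assms(2)] EF by simp_all
    then show False using assms(3) by simp
  qed
  then show ?thesis by (simp add: card_le_Suc0_iff_eq)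
qed

section \<open>Weighted line counts in a solid\<close>

text \<open>\<open>below S\<close> plays the role of \<open>K\<close>. Of its maximality only the
  comparison with lines is kept; an extremal line is turned into this situation by duality.\<close>

locale heavy_solid = regular_plane_set +
  fixes S
  assumes solid: "S \<in> Solids"
    and below_le: "below S \<le> (q + 1)\<^sup>2"
    and above_le: "l \<in> Lines \<Longrightarrow> above l \<le> below S"
begin

abbreviation "X \<equiv> {E \<in> L. E \<subseteq> S}"
abbreviation "\<Lambda> \<equiv> {l \<in> Lines. l \<subseteq> S}"

text \<open>For a line of \<open>S\<close> this is \<open>e_l\<close>: a plane on \<open>l\<close>
  not inside \<open>S\<close> meets \<open>S\<close> exactly in \<open>l\<close>.\<close>

definition excess :: "('a ^ 6) set \<Rightarrow> int" where
  "excess l = above l - between l S"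

text \<open>Two meanings: the number of planes of \<open>S\<close> outside \<open>L\<close>, and the
  total excess on the lines of a plane of \<open>L\<close> in \<open>S\<close>.\<close>

definition N :: int where "N = q ^ 3 + q\<^sup>2 + q + 1 - below S"

lemma below_eq: "below S = int (card X)"
  by (simp add: below_def)

lemma between_eq: "between l S = int (card {E \<in> X. l \<subseteq> E})"
  unfolding between_def by (auto intro!: arg_cong[where f = card])

lemma excess_nonneg: "excess l \<ge> 0"
  using between_le_above by (simp add: excess_def)

lemma between_le: "l \<in> \<Lambda> \<Longrightarrow> between l S \<le> q + 1"
proof -
  assume l: "l \<in> \<Lambda>"
  have "card {E \<in> L. l \<subseteq> E \<and> E \<subseteq> S} \<le> card {E \<in> Planes. l \<subseteq> E \<and> E \<subseteq> S}"
    using L_planes by (intro card_mono) auto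
  then show ?thesis using card_planes_line_solid[OF _ solid, of l] l by (simp add: between_def)
qed

text \<open>Distinct planes of a solid always meet in a line, so each plane of \<open>X\<close>
  other than \<open>E\<close> is counted exactly once.\<close>

lemma sum_between_plane:
  assumes E: "E \<in> Planes" "E \<subseteq> S"
  shows "(\<Sum>l | l \<in> Lines \<and> l \<subseteq> E. between l S) = below S + (if E \<in> L then q\<^sup>2 + q else 0)"
proof -
  have "(\<Sum>l | l \<in> Lines \<and> l \<subseteq> E. between l S) =
      (\<Sum>F\<in>X. int (card {l \<in> {l \<in> Lines. l \<subseteq> E}. l \<subseteq> F}))"
    unfolding between_eq by (rule sum_card_swap) auto
  also have "\<dots> = (\<Sum>F\<in>X. if F = E then q\<^sup>2 + q + 1 else 1)"
  proof (rule sum.cong[OF refl])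
    fix F assume F: "F \<in> X"
    show "int (card {l \<in> {l \<in> Lines. l \<subseteq> E}. l \<subseteq> F}) = (if F = E then q\<^sup>2 + q + 1 else 1)"
    proof (cases "F = E")
      case True
      then have "{l \<in> {l \<in> Lines. l \<subseteq> E}. l \<subseteq> F} = {l \<in> Lines. l \<subseteq> E}" by auto
      then show ?thesis using True card_lines_plane[OF E(1)] by simp
    next
      case False
      have "{l \<in> {l \<in> Lines. l \<subseteq> E}. l \<subseteq> F} = {l \<in> Lines. l \<subseteq> E \<and> l \<subseteq> F}" by auto
      also have "\<dots> = {E \<inter> F}"
        using False lines_in_two_planes[OF E(1), of F] planes_in_solid_meet[OF E(1), of F S] solid E F
          L_planes by (simp add: subset_iff)
      finally show ?thesis using False by simp
    qed
  qed
  also have "\<dots> = below S + (if E \<in> L then q\<^sup>2 + q else 0)"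
  proof -
    have "{F \<in> X. F = E} = (if E \<in> L then {E} else {})" using E by auto
    then show ?thesis by (simp add: sum_if_card below_eq)
  qed
  finally show ?thesis .
qed

lemma sum_excess_plane:
  assumes E: "E \<in> Planes" "E \<subseteq> S"
  shows "(\<Sum>l | l \<in> \<Lambda> \<and> l \<subseteq> E. excess l) = (if E \<in> L then N else (q + 1)\<^sup>2 - below S)"
proof -
  have "{l. l \<in> \<Lambda> \<and> l \<subseteq> E} = {l. l \<in> Lines \<and> l \<subseteq> E}" using E by auto
  then show ?thesis
    using sum_above_plane[OF E(1)] sum_between_plane[OF E]
    by (simp add: excess_def sum_subtractf N_def algebra_simps power2_eq_square)
qed

text \<open>Of the planes of \<open>S\<close>, the \<open>N\<close> outside \<open>L\<close> carry
  excess \<open>(q + 1)^2 - K\<close> each and the \<open>K\<close> in \<open>L\<close> carry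
  \<open>N\<close> each, together \<open>(q + 1)^2 * N\<close>; every line is counted
  \<open>q + 1\<close> times.\<close>

lemma sum_excess: "(\<Sum>l\<in>\<Lambda>. excess l) = (q + 1) * N"
proof -
  let ?ES = "{E \<in> Planes. E \<subseteq> S}"
  have "(\<Sum>E\<in>?ES. \<Sum>l | l \<in> \<Lambda> \<and> l \<subseteq> E. excess l) = (\<Sum>l\<in>\<Lambda>. excess l * int (card {E \<in> ?ES. l \<subseteq> E}))"
    by (rule sum_weighted_swap) auto
  also have "\<dots> = (\<Sum>l\<in>\<Lambda>. excess l * (q + 1))"
  proof (rule sum.cong[OF refl])
    fix l assume l: "l \<in> \<Lambda>"
    have "{E \<in> ?ES. l \<subseteq> E} = {E \<in> Planes. l \<subseteq> E \<and> E \<subseteq> S}" by auto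
    then show "excess l * int (card {E \<in> ?ES. l \<subseteq> E}) = excess l * (q + 1)"
      using card_planes_line_solid[OF _ solid, of l] l by simp
  qed
  also have "\<dots> = (q + 1) * (\<Sum>l\<in>\<Lambda>. excess l)" by (simp add: sum_distrib_left mult.commute)
  finally have lhs: "(\<Sum>E\<in>?ES. \<Sum>l | l \<in> \<Lambda> \<and> l \<subseteq> E. excess l) = (q + 1) * (\<Sum>l\<in>\<Lambda>. excess l)" .
  have "(\<Sum>E\<in>?ES. \<Sum>l | l \<in> \<Lambda> \<and> l \<subseteq> E. excess l) =
      (\<Sum>E\<in>?ES. if E \<in> L then N else (q + 1)\<^sup>2 - below S)"
    using sum_excess_plane by (intro sum.cong) auto
  also have "\<dots> = ((q + 1)\<^sup>2 - below S) * (q ^ 3 + q\<^sup>2 + q + 1) + (N - ((q + 1)\<^sup>2 - below S)) * below S"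
    using card_planes_solid[OF solid] by (simp add: sum_if_card below_eq_card_planes)
  finally have "(q + 1) * (\<Sum>l\<in>\<Lambda>. excess l) = (q + 1) * ((q + 1) * N)"
    unfolding lhs N_def by algebra
  then show ?thesis using q_ge by simp
qed

lemma sum_over_X_planes:
  "(\<Sum>E\<in>X. \<Sum>l | l \<in> \<Lambda> \<and> l \<subseteq> E. g l) = (\<Sum>l\<in>\<Lambda>. g l * between l S)" for g :: "_ \<Rightarrow> int"
  unfolding between_eq by (rule sum_weighted_swap) auto

lemma sum_excess_between: "(\<Sum>l\<in>\<Lambda>. excess l * between l S) = below S * N"
proof -
  have "(\<Sum>E\<in>X. \<Sum>l | l \<in> \<Lambda> \<and> l \<subseteq> E. excess l) = (\<Sum>E\<in>X. N)"
  proof (rule sum.cong[OF refl])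
    fix E assume "E \<in> X"
    then show "(\<Sum>l | l \<in> \<Lambda> \<and> l \<subseteq> E. excess l) = N" using sum_excess_plane[of E] L_planes by auto
  qed
  then show ?thesis unfolding sum_over_X_planes by (simp add: below_eq)
qed

text \<open>Both sides count ordered pairs of distinct planes of \<open>X\<close>, by the line in
  which they meet; the proof reads this off from the sums of \<open>t^2\<close> and
  \<open>t\<close>.\<close>

lemma sum_between_pairs: "(\<Sum>l\<in>\<Lambda>. between l S * (between l S - 1)) = below S * (below S - 1)"
proof -
  have sub: "{l. l \<in> \<Lambda> \<and> l \<subseteq> E} = {l. l \<in> Lines \<and> l \<subseteq> E}" if "E \<in> X" for E using that by auto
  have "(\<Sum>E\<in>X. \<Sum>l | l \<in> \<Lambda> \<and> l \<subseteq> E. between l S) = (\<Sum>E\<in>X. below S + (q\<^sup>2 + q))"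
  proof (rule sum.cong[OF refl])
    fix E assume E: "E \<in> X"
    then show "(\<Sum>l | l \<in> \<Lambda> \<and> l \<subseteq> E. between l S) = below S + (q\<^sup>2 + q)"
      using sum_between_plane[of E] L_planes sub[OF E] by auto
  qed
  then have 1: "(\<Sum>l\<in>\<Lambda>. between l S * between l S) = below S * (below S + (q\<^sup>2 + q))"
    unfolding sum_over_X_planes by (simp add: below_eq)
  have "(\<Sum>E\<in>X. \<Sum>l | l \<in> \<Lambda> \<and> l \<subseteq> E. 1) = (\<Sum>E\<in>X. q\<^sup>2 + q + 1)"
  proof (rule sum.cong[OF refl])
    fix E assume E: "E \<in> X"
    then show "(\<Sum>l | l \<in> \<Lambda> \<and> l \<subseteq> E. 1) = q\<^sup>2 + q + 1"
      using card_lines_plane[of E] L_planes sub[OF E] by auto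
  qed
  then have 2: "(\<Sum>l\<in>\<Lambda>. between l S) = below S * (q\<^sup>2 + q + 1)"
    using sum_over_X_planes[of "\<lambda>_. 1"] by (simp add: below_eq)
  show ?thesis using 1 2 by (simp add: right_diff_distrib sum_subtractf algebra_simps)
qed

lemma excess_le: "l \<in> Lines \<Longrightarrow> excess l \<le> below S - between l S"
  using above_le by (simp add: excess_def)

text \<open>Some plane of \<open>S\<close> on \<open>l\<close> lies outside \<open>L\<close>. By
  \<open>sum_excess_plane\<close> the bound is the total excess of its lines, one of which is
  \<open>l\<close>.\<close>

lemma excess_le_non_full:
  assumes l: "l \<in> \<Lambda>" and nf: "between l S \<le> q"
  shows "excess l \<le> (q + 1)\<^sup>2 - below S"
proof -
  have "\<exists>E\<in>{E \<in> Planes. l \<subseteq> E \<and> E \<subseteq> S}. E \<notin> L"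
  proof (rule ccontr)
    assume "\<not> ?thesis"
    then have "card {E \<in> Planes. l \<subseteq> E \<and> E \<subseteq> S} \<le> card {E \<in> L. l \<subseteq> E \<and> E \<subseteq> S}"
      by (intro card_mono) auto
    then show False using card_planes_line_solid[OF _ solid, of l] l nf by (simp add: between_def)
  qed
  then obtain E where E: "E \<in> Planes" "l \<subseteq> E" "E \<subseteq> S" "E \<notin> L" by auto
  have "excess l \<le> (\<Sum>l | l \<in> \<Lambda> \<and> l \<subseteq> E. excess l)"
    using l E excess_nonneg by (intro member_le_sum) auto
  then show ?thesis using sum_excess_plane[OF E(1,3)] E by simp
qed

text \<open>A weighted variance, centred at the mean \<open>below S / (q + 1)\<close> of
  \<open>between l S\<close> under the weights \<open>excess l\<close> and cleared of
  denominators.\<close>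

lemma sum_excess_square_ge:
  "(q + 1)\<^sup>2 * (\<Sum>l\<in>\<Lambda>. excess l * (between l S)\<^sup>2) - 2 * below S * (q + 1) * (below S * N)
     + (below S)\<^sup>2 * ((q + 1) * N) \<ge> 0"
proof -
  have "0 \<le> (\<Sum>l\<in>\<Lambda>. excess l * ((q + 1) * between l S - below S)\<^sup>2)"
    using excess_nonneg by (intro sum_nonneg) auto
  also have "\<dots> = (\<Sum>l\<in>\<Lambda>. (q + 1)\<^sup>2 * (excess l * (between l S)\<^sup>2)
      - 2 * below S * (q + 1) * (excess l * between l S) + (below S)\<^sup>2 * excess l)"
    by (intro sum.cong) (auto simp: power2_eq_square algebra_simps)
  finally show ?thesis
    by (simp add: sum.distrib sum_subtractf sum_distrib_left[symmetric] sum_excess sum_excess_between)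
qed

text \<open>No integer lies strictly between 1 and 2. This settles the case
  \<open>below S = q + 2\<close>, where the variance bound is too weak.\<close>

lemma sum_excess_quadratic_ge:
  "(\<Sum>l\<in>\<Lambda>. excess l * (between l S)\<^sup>2) - 3 * (below S * N) + 2 * ((q + 1) * N) \<ge> 0"
proof -
  have *: "(t - 1) * (t - 2) \<ge> 0" for t :: int
    by (cases "t \<le> 1") (auto intro: mult_nonpos_nonpos)
  have "0 \<le> (\<Sum>l\<in>\<Lambda>. excess l * ((between l S - 1) * (between l S - 2)))"
    by (intro sum_nonneg mult_nonneg_nonneg[OF excess_nonneg *])
  also have "\<dots> = (\<Sum>l\<in>\<Lambda>. excess l * (between l S)\<^sup>2 - 3 * (excess l * between l S) + 2 * excess l)"
    by (intro sum.cong) (auto simp: power2_eq_square algebra_simps)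
  finally show ?thesis
    by (simp add: sum.distrib sum_subtractf sum_distrib_left[symmetric] sum_excess sum_excess_between)
qed

lemma sum_excess_pairs:
  "(\<Sum>l\<in>\<Lambda>. excess l * (between l S * (between l S - 1))) =
    (\<Sum>l\<in>\<Lambda>. excess l * (between l S)\<^sup>2) - below S * N"
proof -
  have "(\<Sum>l\<in>\<Lambda>. excess l * (between l S * (between l S - 1))) =
      (\<Sum>l\<in>\<Lambda>. excess l * (between l S)\<^sup>2 - excess l * between l S)"
    by (intro sum.cong) (auto simp: power2_eq_square algebra_simps)
  then show ?thesis by (simp add: sum_subtractf sum_excess_between)
qed

lemma pairs_nonneg: "between l S * (between l S - 1) \<ge> 0"
  using between_nonneg[of l S] by (cases "between l S = 0") auto

text \<open>Lines with at most one plane of \<open>X\<close> have weight 0, and on all others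
  \<open>excess_le\<close> gives at most \<open>below S - 2\<close>.\<close>

lemma sum_excess_pairs_le:
  "(\<Sum>l\<in>\<Lambda>. excess l * (between l S * (between l S - 1))) \<le> (below S - 2) * (below S * (below S - 1))"
proof -
  have "(\<Sum>l\<in>\<Lambda>. excess l * (between l S * (between l S - 1))) \<le>
      (\<Sum>l\<in>\<Lambda>. (below S - 2) * (between l S * (between l S - 1)))"
  proof (rule sum_mono)
    fix l assume l: "l \<in> \<Lambda>"
    show "excess l * (between l S * (between l S - 1)) \<le> (below S - 2) * (between l S * (between l S - 1))"
    proof (cases "between l S \<ge> 2")
      case True
      then show ?thesis using excess_le[of l] l pairs_nonneg by (intro mult_right_mono) auto
    next
      case False
      then have "between l S = 0 \<or> between l S = 1" using between_nonneg[of l S] by auto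
      then show ?thesis by auto
    qed
  qed
  then show ?thesis by (simp add: sum_distrib_left[symmetric] sum_between_pairs)
qed

section \<open>Points of the solid and its full lines\<close>

text \<open>A plane of \<open>L\<close> on \<open>P\<close> contains \<open>q + 1\<close> lines of
  \<open>S\<close> on \<open>P\<close> if it lies in \<open>S\<close>, and at most one otherwise. So
  \<open>between P S\<close> enters this estimate with factor \<open>q\<close>, but the exact value
  in \<open>sum_above_lines_point_solid\<close> with factor \<open>q * (q + 1)\<close>.\<close>

lemma between_point_le:
  assumes P: "P \<in> Points" "P \<subseteq> S"
  shows "between P S \<le> 2 * q + 2"
proof -
  have "(\<Sum>l | l \<in> Lines \<and> P \<subseteq> l \<and> l \<subseteq> S. above l) =
      (\<Sum>F\<in>L. int (card {l \<in> {l \<in> Lines. P \<subseteq> l \<and> l \<subseteq> S}. l \<subseteq> F}))"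
    unfolding above_def by (rule sum_card_swap) auto
  also have "\<dots> \<le> (\<Sum>F\<in>L. (if P \<subseteq> F then 1 else 0) + (if P \<subseteq> F \<and> F \<subseteq> S then q else 0))"
  proof (rule sum_mono)
    fix F assume F: "F \<in> L"
    then have FP: "F \<in> Planes" using L_planes by auto
    let ?A = "{l \<in> {l \<in> Lines. P \<subseteq> l \<and> l \<subseteq> S}. l \<subseteq> F}"
    consider "\<not> P \<subseteq> F" | "P \<subseteq> F" "F \<subseteq> S" | "P \<subseteq> F" "\<not> F \<subseteq> S" by blast
    then show "int (card ?A) \<le> (if P \<subseteq> F then 1 else 0) + (if P \<subseteq> F \<and> F \<subseteq> S then q else 0)"
    proof cases
      case 1
      then have A: "?A = {}" by blast
      show ?thesis unfolding A using 1 by simp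
    next
      case 2
      then have "?A = {l \<in> Lines. P \<subseteq> l \<and> l \<subseteq> F}" by blast
      then show ?thesis using card_lines_point_plane[OF P(1) FP] 2 by simp
    next
      case 3
      obtain k where k: "F \<inter> S \<in> subs k" "k \<le> 3" using subs_Int_join[OF FP solid] by auto
      have "k \<noteq> 3"
      proof
        assume "k = 3"
        then have "F \<inter> S = F" using subs_eqI[of "F \<inter> S" 3 F] k FP by simp
        then show False using 3 by blast
      qed
      then have "k \<le> 2" using k by simp
      have "l = F \<inter> S" if l: "l \<in> ?A" for l
      proof -
        have "l \<in> Lines" "l \<subseteq> F \<inter> S" using l by auto
        moreover from this have "k = 2" using subs_dim_le[OF _ k(1)] \<open>k \<le> 2\<close> by fastforce
        ultimately show ?thesis using subs_eqI k(1) by blast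
      qed
      then have "?A \<subseteq> {F \<inter> S}" by blast
      then have "card ?A \<le> card {F \<inter> S}" by (intro card_mono) auto
      then show ?thesis using 3 by simp
    qed
  qed
  also have "\<dots> = above P + q * between P S"
    by (simp add: sum.distrib sum_if_card above_def between_def)
  finally have "(q + 1)\<^sup>2 + q * (q + 1) * between P S - q * below S \<le>
      (q + 1) * (q\<^sup>2 + 1) + q * between P S"
    using sum_above_lines_point_solid[OF P(1) solid P(2)] above_point[OF P(1)] by simp
  then have "q * (q * between P S) \<le> q * (below S + q\<^sup>2 - 1)"
    by (simp add: algebra_simps power2_eq_square)
  then have "q * between P S \<le> below S + q\<^sup>2 - 1" using q_ge by simp
  also have "\<dots> \<le> q * (2 * q + 2)" using below_le by (simp add: algebra_simps power2_eq_square)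
  finally show ?thesis using q_ge by simp
qed

text \<open>Three full lines through a point would give at least \<open>3 * q\<close> planes on it, so the full lines
  through a point number at most two, and by double counting there are few of them.\<close>

definition full_lines :: "('a ^ 6) set set" where
  "full_lines = {l \<in> \<Lambda>. between l S = q + 1}"

lemma card_common_X_planes_le_1:
  assumes "l \<in> full_lines" "m \<in> full_lines" "l \<noteq> m"
  shows "card {E \<in> X. l \<subseteq> E \<and> m \<subseteq> E} \<le> 1"
proof -
  have "card {E \<in> X. l \<subseteq> E \<and> m \<subseteq> E} \<le> card {E \<in> Planes. l \<subseteq> E \<and> m \<subseteq> E}"
    using L_planes by (intro card_mono) auto
  also have "\<dots> \<le> 1"
    using assms by (intro card_common_planes_le_1) (auto simp: full_lines_def)
  finally show ?thesis .
qed

lemma full_lines_point: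
  assumes P: "P \<in> Points" and lmn: "l \<in> full_lines" "m \<in> full_lines" "n \<in> full_lines"
    and Psub: "P \<subseteq> l" "P \<subseteq> m" "P \<subseteq> n" and "l \<noteq> m" "l \<noteq> n"
  shows "m = n"
proof (rule ccontr)
  assume "m \<noteq> n"
  define A where "A k = {E \<in> X. k \<subseteq> E}" for k
  have card_A: "int (card (A k)) = q + 1" if "k \<in> full_lines" for k
    using that by (simp add: A_def full_lines_def between_eq)
  have card_AA: "card (A k \<inter> A k') \<le> 1" if "k \<in> full_lines" "k' \<in> full_lines" "k \<noteq> k'" for k k'
  proof -
    have "A k \<inter> A k' = {E \<in> X. k \<subseteq> E \<and> k' \<subseteq> E}" by (auto simp: A_def)
    then show ?thesis using card_common_X_planes_le_1[OF that] by simp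
  qed
  have "card (A l \<union> A m) + card (A l \<inter> A m) = card (A l) + card (A m)"
    by (simp add: card_Un_Int[symmetric])
  then have 1: "int (card (A l \<union> A m)) \<ge> 2 * q + 1"
    using card_A[of l] card_A[of m] card_AA[of l m] assms by linarith
  have "(A l \<union> A m) \<inter> A n = (A l \<inter> A n) \<union> (A m \<inter> A n)" by auto
  then have "card ((A l \<union> A m) \<inter> A n) \<le> card (A l \<inter> A n) + card (A m \<inter> A n)"
    by (simp add: card_Un_le)
  then have 2: "card ((A l \<union> A m) \<inter> A n) \<le> 2"
    using card_AA[of l n] card_AA[of m n] assms \<open>m \<noteq> n\<close> by linarith
  have "card (A l \<union> A m \<union> A n) + card ((A l \<union> A m) \<inter> A n) = card (A l \<union> A m) + card (A n)"
    by (simp add: card_Un_Int[symmetric])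
  \<comment> \<open>Inclusion-exclusion: \<open>(2 * q + 1) + (q + 1) - 2\<close>.\<close>
  then have 3: "int (card (A l \<union> A m \<union> A n)) \<ge> 3 * q"
    using 1 2 card_A[of n] assms by linarith
  have "A l \<union> A m \<union> A n \<subseteq> {E \<in> L. P \<subseteq> E \<and> E \<subseteq> S}" using Psub by (auto simp: A_def)
  then have "card (A l \<union> A m \<union> A n) \<le> card {E \<in> L. P \<subseteq> E \<and> E \<subseteq> S}" by (intro card_mono) auto
  then have "between P S \<ge> 3 * q" using 3 by (simp add: between_def)
  moreover have "P \<subseteq> S" using Psub lmn by (auto simp: full_lines_def)
  ultimately show False using between_point_le[OF P] q_ge by linarith
qed

lemma card_full_lines: "(q + 1) * int (card full_lines) \<le> 2 * below S"
proof -
  define \<phi> where "\<phi> E = int (card {l \<in> full_lines. l \<subseteq> E})" for E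
  have card_X: "int (card {E \<in> X. l \<subseteq> E}) = q + 1" if "l \<in> full_lines" for l
    using that by (simp add: full_lines_def between_eq)
  have "(\<Sum>E\<in>X. \<phi> E) = (\<Sum>l\<in>full_lines. int (card {E \<in> X. l \<subseteq> E}))"
    unfolding \<phi>_def by (rule sum_card_swap) auto
  also have "\<dots> = (q + 1) * int (card full_lines)" using card_X by simp
  finally have sum_\<phi>: "(\<Sum>E\<in>X. \<phi> E) = (q + 1) * int (card full_lines)" .
  \<comment> \<open>The line \<open>l\<close> itself accounts for \<open>q + 1\<close>. Any other
    full line coplanar with \<open>l\<close> in a plane of \<open>X\<close> shares only one such
    plane with it, and different ones meet \<open>l\<close> in different points by
    \<open>full_lines_point\<close>, so they add at most another \<open>q + 1\<close>.\<close>
  have bound: "(\<Sum>E\<in>{E \<in> X. l \<subseteq> E}. \<phi> E) \<le> 2 * (q + 1)" if l: "l \<in> full_lines" for l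
  proof -
    let ?M = "{m \<in> full_lines. m \<noteq> l \<and> {E \<in> X. l \<subseteq> E \<and> m \<subseteq> E} \<noteq> {}}"
    have lL: "l \<in> Lines" "l \<subseteq> S" using l by (auto simp: full_lines_def)
    have meet: "l \<inter> m \<in> Points" if m: "m \<in> ?M" for m
    proof -
      obtain E where "E \<in> X" "l \<subseteq> E" "m \<subseteq> E" using m by auto
      then show ?thesis
        using lines_in_plane_meet[OF lL(1), of m E] m L_planes by (auto simp: full_lines_def)
    qed
    have "card ?M \<le> card {P \<in> Points. P \<subseteq> l}"
    proof (rule card_inj_on_le[where f = "\<lambda>m. l \<inter> m"])
      show "inj_on (\<lambda>m. l \<inter> m) ?M"
      proof (rule inj_onI)
        fix m n assume mn: "m \<in> ?M" "n \<in> ?M" and eq: "l \<inter> m = l \<inter> n"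
        have ne: "l \<noteq> m" "l \<noteq> n" using mn by auto
        show "m = n"
        proof (rule full_lines_point[OF meet[OF mn(1)] l])
          show "l \<inter> m \<subseteq> n" unfolding eq by simp
        qed (use mn ne in simp_all)
      qed
      show "(\<lambda>m. l \<inter> m) ` ?M \<subseteq> {P \<in> Points. P \<subseteq> l}"
        using meet by blast
    qed simp
    then have M: "int (card ?M) \<le> q + 1" using card_points_line[OF lL(1)] by simp
    have "(\<Sum>E\<in>{E \<in> X. l \<subseteq> E}. \<phi> E) = (\<Sum>m\<in>full_lines. int (card {E \<in> {E \<in> X. l \<subseteq> E}. m \<subseteq> E}))"
      unfolding \<phi>_def by (rule sum_card_swap) auto
    also have "\<dots> \<le> (\<Sum>m\<in>full_lines. (if m = l then q + 1 else 0) + (if m \<in> ?M then 1 else 0))"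
    proof (rule sum_mono)
      fix m assume m: "m \<in> full_lines"
      have eq: "{E \<in> {E \<in> X. l \<subseteq> E}. m \<subseteq> E} = {E \<in> X. l \<subseteq> E \<and> m \<subseteq> E}" by auto
      show "int (card {E \<in> {E \<in> X. l \<subseteq> E}. m \<subseteq> E}) \<le> (if m = l then q + 1 else 0) + (if m \<in> ?M then 1 else 0)"
      proof (cases "m = l")
        case True
        then show ?thesis using card_X[OF l] unfolding eq by simp
      next
        case False
        then show ?thesis
          using card_common_X_planes_le_1[OF l m] m q_ge unfolding eq by (cases "m \<in> ?M") auto
      qed
    qed
    also have "\<dots> = (q + 1) + int (card {m \<in> full_lines. m \<in> ?M})"
      using l by (simp add: sum.distrib sum_if_card)
    also have "{m \<in> full_lines. m \<in> ?M} = ?M" by auto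
    finally show ?thesis using M by simp
  qed
  have "(\<Sum>E\<in>X. \<phi> E * \<phi> E) = (\<Sum>E\<in>X. \<Sum>l | l \<in> full_lines \<and> l \<subseteq> E. \<phi> E)"
    unfolding \<phi>_def by simp
  also have "\<dots> = (\<Sum>l\<in>full_lines. \<Sum>E | E \<in> X \<and> l \<subseteq> E. \<phi> E)"
    by (rule sum.swap_restrict) auto
  also have "\<dots> \<le> (\<Sum>l\<in>full_lines. 2 * (q + 1))"
    using bound by (intro sum_mono) simp
  finally have sum_\<phi>\<phi>: "(\<Sum>E\<in>X. \<phi> E * \<phi> E) \<le> 2 * ((q + 1) * int (card full_lines))"
    by (simp add: algebra_simps)
  have "(t - 1) * (t - 2) \<ge> 0" for t :: int
    by (cases "t \<le> 1") (auto intro: mult_nonpos_nonpos)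
  \<comment> \<open>With \<open>F = (q + 1) * card full_lines\<close> the expansion gives
    \<open>0 <= 2 * F - 3 * F + 2 * below S\<close>.\<close>
  then have "0 \<le> (\<Sum>E\<in>X. (\<phi> E - 1) * (\<phi> E - 2))" by (intro sum_nonneg) auto
  also have "\<dots> = (\<Sum>E\<in>X. \<phi> E * \<phi> E - 3 * \<phi> E + 2)"
    by (intro sum.cong) (auto simp: algebra_simps)
  finally show ?thesis
    using sum_\<phi> sum_\<phi>\<phi> by (simp add: sum.distrib sum_subtractf sum_distrib_left[symmetric] below_eq)
qed

text \<open>\<open>excess_le_non_full\<close> handles every line that is not full. A full line has
  weight \<open>q * (q + 1)\<close> and excess at most \<open>below S - q - 1\<close>, paid for by
  the last summand.\<close>

lemma sum_excess_pairs_le_full: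
  "(\<Sum>l\<in>\<Lambda>. excess l * (between l S * (between l S - 1))) \<le>
    ((q + 1)\<^sup>2 - below S) * (below S * (below S - 1)) +
    int (card full_lines) * ((below S - q - 1) * (q * (q + 1)))"
proof -
  let ?c = "(below S - q - 1) * (q * (q + 1))"
  have "(\<Sum>l\<in>\<Lambda>. excess l * (between l S * (between l S - 1))) \<le>
      (\<Sum>l\<in>\<Lambda>. ((q + 1)\<^sup>2 - below S) * (between l S * (between l S - 1)) + (if between l S = q + 1 then ?c else 0))"
  proof (rule sum_mono)
    fix l assume l: "l \<in> \<Lambda>"
    show "excess l * (between l S * (between l S - 1)) \<le>
      ((q + 1)\<^sup>2 - below S) * (between l S * (between l S - 1)) + (if between l S = q + 1 then ?c else 0)"
    proof (cases "between l S = q + 1")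
      case True
      have "excess l * ((q + 1) * q) \<le> (below S - (q + 1)) * ((q + 1) * q)"
        using excess_le[of l] l True q_ge by (intro mult_right_mono) auto
      moreover have "0 \<le> ((q + 1)\<^sup>2 - below S) * ((q + 1) * q)"
        using below_le q_ge by (intro mult_nonneg_nonneg) auto
      ultimately show ?thesis using True by (simp add: algebra_simps)
    next
      case False
      then have "between l S \<le> q" using between_le[OF l] by simp
      then have "excess l * (between l S * (between l S - 1)) \<le>
          ((q + 1)\<^sup>2 - below S) * (between l S * (between l S - 1))"
        using excess_le_non_full[OF l] pairs_nonneg by (intro mult_right_mono) auto
      then show ?thesis using False by simp
    qed
  qed
  also have "\<dots> = ((q + 1)\<^sup>2 - below S) * (below S * (below S - 1)) + ?c * int (card {l \<in> \<Lambda>. between l S = q + 1})"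
    using sum_between_pairs by (simp add: sum.distrib sum_distrib_left[symmetric] sum_if_card)
  finally show ?thesis by (simp add: full_lines_def mult.commute)
qed

lemma below_le_Suc_q: "below S \<le> q + 1"
proof (rule ccontr)
  assume "\<not> ?thesis"
  then have K: "below S > q + 1" by simp
  show False
  \<comment> \<open>The excess bounds \<open>below S - 2\<close> and
    \<open>(q + 1)^2 - below S\<close> are about equal at this threshold; each case uses the smaller
    one.\<close>
  proof (cases "2 * below S \<le> (q + 1)\<^sup>2")
    case True
    show False
      using weighted_count_contradiction_light[OF q_ge K True N_def refl refl _
          sum_excess_quadratic_ge sum_excess_square_ge]
        sum_excess_pairs sum_excess_pairs_le by simp
  next
    case False
    show False
      using weighted_count_contradiction_heavy[OF q_ge below_le _ N_def refl refl _
          card_full_lines sum_excess_square_ge] False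
        sum_excess_pairs sum_excess_pairs_le_full by simp
  qed
qed

end

section \<open>Duality and the polarity\<close>

context projective_5_space
begin

lemma dual_subs:
  fixes U :: "('a ^ 6) set"
  assumes "U \<in> subs k" "k + m = 6"
  shows "dot.perp U \<in> subs m"
proof -
  have "m = CARD(6) - k" using assms(2) by simp
  then show ?thesis using dot.perp_in_subs[OF assms(1)] by simp
qed

lemma dual_dual: "U \<in> subs k \<Longrightarrow> dot.perp (dot.perp U) = U" for U :: "('a ^ 6) set"
  by (simp add: subs_def dot.perp_perp)

lemma dual_subset_iff:
  "U \<in> subs k \<Longrightarrow> W \<in> subs m \<Longrightarrow> dot.perp U \<subseteq> dot.perp W \<longleftrightarrow> W \<subseteq> U" for U W :: "('a ^ 6) set"
  by (simp add: subs_def dot.perp_subset_iff)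

end

context regular_plane_set
begin

abbreviation "dual_L \<equiv> dot.perp ` L"

lemma inj_on_dual: "inj_on dot.perp L"
proof (rule inj_on_inverseI[where g = dot.perp])
  fix E assume "E \<in> L"
  then show "dot.perp (dot.perp E) = E" using L_planes dual_dual by blast
qed

lemma card_image_dual: "A \<subseteq> L \<Longrightarrow> card (dot.perp ` A) = card A"
  by (rule card_image[OF inj_on_subset[OF inj_on_dual]])

text \<open>Two planes meet in a line iff their join is a solid, and \<open>dot.perp\<close>
  exchanges meet and join; so it preserves neighbourhood of planes.\<close>

lemma dual_regular: "regular_plane_set q dual_L"
proof (unfold_locales)
  show "dual_L \<subseteq> subs 3" using L_planes dual_subs[of _ 3 3] by auto
  show "int (card dual_L) = (q + 1)\<^sup>2 * (q\<^sup>2 + 1) * (q\<^sup>2 - q + 1)"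
    using card_L card_image_dual by simp
  fix E :: "('a ^ 6) set" assume E: "E \<in> subs 3"
  let ?E = "dot.perp E"
  have E': "?E \<in> Planes" using dual_subs[OF E] by simp
  have "G \<in> L \<Longrightarrow> (dot.perp G \<noteq> E \<and> E \<inter> dot.perp G \<in> subs 2) \<longleftrightarrow> (G \<noteq> ?E \<and> ?E \<inter> G \<in> subs 2)" for G
  proof -
    assume "G \<in> L"
    then have G: "G \<in> Planes" using L_planes by auto
    have ne: "dot.perp G = E \<longleftrightarrow> G = ?E" using dual_dual[OF G] dual_dual[OF E] by auto
    have J: "vec.subspace (join ?E G)" by simp
    have "E \<inter> dot.perp G = dot.perp (join ?E G)" using dual_dual[OF E] by (simp add: dot.perp_join)
    moreover have "dot.perp (join ?E G) \<in> subs 2 \<longleftrightarrow> join ?E G \<in> subs 4"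
      using dual_subs[of "join ?E G" 4 2] dual_subs[of "dot.perp (join ?E G)" 2 4] dot.perp_perp[OF J]
      by auto
    moreover have "join ?E G \<in> subs 4 \<longleftrightarrow> ?E \<inter> G \<in> subs 2"
      using subs_Int_join_iff[OF E' G, of 2 4] by simp
    ultimately show ?thesis using ne by simp
  qed
  then have "{F \<in> dual_L. F \<noteq> E \<and> E \<inter> F \<in> subs 2} =
      dot.perp ` {G \<in> L. G \<noteq> ?E \<and> ?E \<inter> G \<in> subs 2}"
    by (simp add: Collect_conj_eq image_def) blast
  moreover have "E \<in> dual_L \<longleftrightarrow> ?E \<in> L"
  proof
    assume "E \<in> dual_L"
    then obtain G where "G \<in> L" "E = dot.perp G" by blast
    then show "?E \<in> L" using dual_dual[of G 3] L_planes by auto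
  next
    assume "?E \<in> L"
    then show "E \<in> dual_L" using dual_dual[OF E] by (intro image_eqI[of _ _ ?E]) auto
  qed
  ultimately show "int (card {F \<in> dual_L. F \<noteq> E \<and> E \<inter> F \<in> subs 2}) =
      (q + 1)\<^sup>2 + (if E \<in> dual_L then q ^ 3 - q - 1 else 0)"
    using card_neighbours[OF E'] by (simp add: card_image_dual)
qed

lemma dual_above:
  assumes "U \<in> subs k"
  shows "regular_plane_set.above dual_L U = below (dot.perp U)"
proof -
  interpret D: regular_plane_set q dual_L by (rule dual_regular)
  have "U \<subseteq> dot.perp E \<longleftrightarrow> E \<subseteq> dot.perp U" if "E \<in> L" for E
    using dual_subset_iff[of "dot.perp U" "6 - k" E 3] that L_planes dual_dual[OF assms]
      dot.perp_in_subs[OF assms] by auto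
  then have "{E \<in> dual_L. U \<subseteq> E} = dot.perp ` {E \<in> L. E \<subseteq> dot.perp U}" by auto
  then show ?thesis unfolding D.above_def below_def by (simp add: card_image_dual)
qed

lemma dual_below:
  assumes "U \<in> subs k"
  shows "regular_plane_set.below dual_L U = above (dot.perp U)"
proof -
  interpret D: regular_plane_set q dual_L by (rule dual_regular)
  have "dot.perp E \<subseteq> U \<longleftrightarrow> dot.perp U \<subseteq> E" if "E \<in> L" for E
    using dual_subset_iff[of E 3 "dot.perp U" "6 - k"] that L_planes dual_dual[OF assms]
      dot.perp_in_subs[OF assms] by auto
  then have "{E \<in> dual_L. E \<subseteq> U} = dot.perp ` {E \<in> L. dot.perp U \<subseteq> E}" by auto
  then show ?thesis unfolding D.below_def above_def by (simp add: card_image_dual)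
qed

text \<open>The bound is a premise so that the dual set can use the lemma too, where it speaks about
  solids.\<close>

lemma above_eq_0_or_Suc_q:
  assumes le: "\<And>l. l \<in> Lines \<Longrightarrow> above l \<le> q + 1" and l: "l \<in> Lines"
  shows "above l = 0 \<or> above l = q + 1"
proof (rule disjCI)
  assume "above l \<noteq> q + 1"
  show "above l = 0"
  proof (rule ccontr)
    assume "above l \<noteq> 0"
    then have "{E \<in> L. l \<subseteq> E} \<noteq> {}" by (auto simp: above_def)
    then obtain E where E: "E \<in> L" "l \<subseteq> E" by blast
    then have EP: "E \<in> Planes" using L_planes by auto
    have "(\<Sum>l | l \<in> Lines \<and> l \<subseteq> E. q + 1 - above l) =
        (q\<^sup>2 + q + 1) * (q + 1) - ((q + 1)\<^sup>2 + (q ^ 3 + q\<^sup>2))"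
      using sum_above_plane[OF EP] card_lines_plane[OF EP] E by (simp add: sum_subtractf)
    \<comment> \<open>Here \<open>q + 1\<close> is exactly the average of \<open>above\<close>, so
      the nonnegative deficits all vanish.\<close>
    also have "\<dots> = 0" by (simp add: algebra_simps power2_eq_square power3_eq_cube)
    finally have "\<forall>l\<in>{l \<in> Lines. l \<subseteq> E}. q + 1 - above l = 0"
      using le by (subst (asm) sum_nonneg_eq_0_iff) auto
    then show False using l E \<open>above l \<noteq> q + 1\<close> by auto
  qed
qed

end

locale bounded_plane_set = regular_plane_set +
  assumes above_le: "l \<in> Lines \<Longrightarrow> above l \<le> (q + 1)\<^sup>2"
    and below_le: "S \<in> Solids \<Longrightarrow> below S \<le> (q + 1)\<^sup>2"
    and pencil: "S \<in> Solids \<Longrightarrow> below S = q + 1 \<Longrightarrow> \<exists>l\<in>Lines. \<forall>E\<in>L. E \<subseteq> S \<longrightarrow> l \<subseteq> E"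
begin

lemma above_le_Suc_q: "l \<in> Lines \<Longrightarrow> above l \<le> q + 1"
    and below_le_Suc_q: "S \<in> Solids \<Longrightarrow> below S \<le> q + 1"
proof -
  let ?A = "above ` Lines \<union> below ` Solids"
  define K where "K = Max ?A"
  have fin: "finite ?A" by simp
  have K: "above l \<le> K" if "l \<in> Lines" for l using that fin by (simp add: K_def)
  have K': "below S \<le> K" if "S \<in> Solids" for S using that fin by (simp add: K_def)
  \<comment> \<open>\<open>Max\<close> means something only for a nonempty set; the line or solid in
    the goal supplies an element.\<close>
  have "K \<le> q + 1" if ne: "?A \<noteq> {}"
  proof -
    have "K \<in> ?A" using fin ne Max_in K_def by blast
    then consider S where "S \<in> Solids" "K = below S" | l where "l \<in> Lines" "K = above l" by blast
    then show ?thesis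
    proof cases
      case 1
      interpret heavy_solid q L S
        using 1 K below_le by unfold_locales auto
      show ?thesis using below_le_Suc_q 1 by simp
    next
      \<comment> \<open>An extremal line \<open>l\<close> becomes the solid
        \<open>dot.perp l\<close> of the dual set with the same count, and the bound for solids
        turns into the one required for dual lines.\<close>
      case 2
      interpret D: regular_plane_set q dual_L by (rule dual_regular)
      have S: "dot.perp l \<in> Solids" using dual_subs[OF 2(1)] by simp
      have Kl: "D.below (dot.perp l) = K" using dual_below[OF S] dual_dual[OF 2(1)] 2(2) by simp
      interpret D: heavy_solid q dual_L "dot.perp l"
      proof unfold_locales
        show "dot.perp l \<in> Solids" by (rule S)
        show "D.below (dot.perp l) \<le> (q + 1)\<^sup>2" using Kl 2 above_le by simp
        fix m :: "('a ^ 6) set" assume m: "m \<in> Lines"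
        show "D.above m \<le> D.below (dot.perp l)"
          unfolding Kl dual_above[OF m] using K' dual_subs[OF m] by simp
      qed
      show ?thesis using D.below_le_Suc_q Kl by simp
    qed
  qed
  then show "l \<in> Lines \<Longrightarrow> above l \<le> q + 1" "S \<in> Solids \<Longrightarrow> below S \<le> q + 1"
    using K K' by force+
qed

lemma above_cases: "l \<in> Lines \<Longrightarrow> above l = 0 \<or> above l = q + 1"
  using above_eq_0_or_Suc_q above_le_Suc_q by blast

lemma below_cases:
  assumes S: "S \<in> Solids"
  shows "below S = 0 \<or> below S = q + 1"
proof -
  interpret D: regular_plane_set q dual_L by (rule dual_regular)
  have "D.above l \<le> q + 1" if l: "l \<in> Lines" for l
    unfolding dual_above[OF l] using below_le_Suc_q dual_subs[OF l] by simp
  moreover have "dot.perp S \<in> Lines" using dual_subs[OF S] by simp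
  ultimately have "D.above (dot.perp S) = 0 \<or> D.above (dot.perp S) = q + 1"
    using D.above_eq_0_or_Suc_q by blast
  then show ?thesis using dual_above[OF \<open>dot.perp S \<in> Lines\<close>] dual_dual[OF S] by simp
qed

section \<open>The quotient at a point\<close>

text \<open>These will be the totally isotropic lines.\<close>

definition T :: "('a ^ 6) set set" where
  "T = {l \<in> Lines. above l \<noteq> 0}"

lemma sum_above_eq_card_T:
  assumes "A \<subseteq> Lines"
  shows "(\<Sum>l\<in>A. above l) = (q + 1) * int (card {l \<in> A. l \<in> T})"
proof -
  have "(\<Sum>l\<in>A. above l) = (\<Sum>l\<in>A. if l \<in> T then q + 1 else 0)"
    using above_cases assms by (intro sum.cong) (auto simp: T_def)
  then show ?thesis by (simp add: sum_if_card)
qed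

text \<open>The size of a hyperplane of the quotient PG(4,q) at \<open>P\<close>.\<close>

lemma card_T_point:
  assumes P: "P \<in> Points"
  shows "int (card {l \<in> T. P \<subseteq> l}) = (q + 1) * (q\<^sup>2 + 1)"
proof -
  have "{l \<in> {l \<in> Lines. P \<subseteq> l}. l \<in> T} = {l \<in> T. P \<subseteq> l}" by (auto simp: T_def)
  then have "(q + 1) * int (card {l \<in> T. P \<subseteq> l}) = (q + 1) * ((q + 1) * (q\<^sup>2 + 1))"
    using sum_above_lines_point[OF P] sum_above_eq_card_T[of "{l \<in> Lines. P \<subseteq> l}"] above_point[OF P]
    by simp
  then show ?thesis using q_ge by simp
qed

text \<open>In the quotient at \<open>P\<close> a plane meets \<open>T\<close> in
  \<open>q + 1\<close> points or lies in it. The second case occurs when \<open>S\<close> contains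
  planes of \<open>L\<close> and \<open>P\<close> is on their common line.\<close>

lemma card_T_point_solid:
  assumes P: "P \<in> Points" and S: "S \<in> Solids" and PS: "P \<subseteq> S"
  shows "int (card {l \<in> T. P \<subseteq> l \<and> l \<subseteq> S}) = q + 1 \<or> {l \<in> Lines. P \<subseteq> l \<and> l \<subseteq> S} \<subseteq> T"
proof -
  let ?A = "{l \<in> Lines. P \<subseteq> l \<and> l \<subseteq> S}"
  define c where "c = int (card {l \<in> T. P \<subseteq> l \<and> l \<subseteq> S})"
  have "{l \<in> ?A. l \<in> T} = {l \<in> T. P \<subseteq> l \<and> l \<subseteq> S}" by (auto simp: T_def)
  then have c: "(q + 1) * c = (q + 1)\<^sup>2 + q * (q + 1) * between P S - q * below S"
    using sum_above_lines_point_solid[OF P S PS] sum_above_eq_card_T[of ?A] by (simp add: c_def)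
  show ?thesis
  proof (cases "below S = 0")
    case True
    then have "between P S = 0" using between_le_below[of P S] between_nonneg[of P S] by simp
    then have "(q + 1) * c = (q + 1) * (q + 1)" using c True by (simp add: power2_eq_square)
    then show ?thesis using q_ge by (simp add: c_def)
  next
    case False
    then have below: "below S = q + 1" using below_cases[OF S] by simp
    then obtain l where l: "l \<in> Lines" "\<And>E. E \<in> L \<Longrightarrow> E \<subseteq> S \<Longrightarrow> l \<subseteq> E" using pencil[OF S] by blast
    have "{E \<in> L. E \<subseteq> S} \<noteq> {}" using False by (auto simp: below_def)
    then have lS: "l \<subseteq> S" using l(2) by blast
    have "{E \<in> L. E \<subseteq> S} \<subseteq> {E \<in> Planes. l \<subseteq> E \<and> E \<subseteq> S}" using L_planes l(2) by auto
    moreover have "card {E \<in> L. E \<subseteq> S} = card {E \<in> Planes. l \<subseteq> E \<and> E \<subseteq> S}"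
      using below card_planes_line_solid[OF l(1) S lS] by (simp add: below_def)
    \<comment> \<open>The pencil is complete: \<open>S\<close> has only \<open>q + 1\<close> planes
      on \<open>l\<close>.\<close>
    ultimately have eq: "{E \<in> L. E \<subseteq> S} = {E \<in> Planes. l \<subseteq> E \<and> E \<subseteq> S}"
      by (intro card_subset_eq) auto
    have "{E \<in> L. P \<subseteq> E \<and> E \<subseteq> S} = {E \<in> {E \<in> L. E \<subseteq> S}. P \<subseteq> E}" by auto
    then have betw: "between P S = int (card {E \<in> {E \<in> Planes. l \<subseteq> E \<and> E \<subseteq> S}. P \<subseteq> E})"
      unfolding between_def eq by simp
    show ?thesis
    proof (cases "P \<subseteq> l")
      case True
      then have "{E \<in> {E \<in> Planes. l \<subseteq> E \<and> E \<subseteq> S}. P \<subseteq> E} = {E \<in> Planes. l \<subseteq> E \<and> E \<subseteq> S}" by auto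
      then have "between P S = q + 1" using betw card_planes_line_solid[OF l(1) S lS] by simp
      then have "(q + 1) * c = (q + 1) * (q\<^sup>2 + q + 1)"
        using c below by (simp add: algebra_simps power2_eq_square)
      then have "c = q\<^sup>2 + q + 1" using q_ge by (subst (asm) mult_cancel_left) auto
      then have "card {l \<in> T. P \<subseteq> l \<and> l \<subseteq> S} = card ?A"
        using card_lines_point_solid[OF P S PS] by (simp add: c_def)
      then have "{l \<in> T. P \<subseteq> l \<and> l \<subseteq> S} = ?A"
        by (intro card_subset_eq) (auto simp: T_def)
      then show ?thesis by blast
    next
      case False
      have "join P l \<subseteq> S" using subs_subspace[OF S] PS lS by (rule join_least)
      moreover have "{E \<in> {E \<in> Planes. l \<subseteq> E \<and> E \<subseteq> S}. P \<subseteq> E} = {E \<in> {E \<in> Planes. P \<subseteq> E \<and> l \<subseteq> E}. E \<subseteq> S}"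
        by auto
      ultimately have "{E \<in> {E \<in> Planes. l \<subseteq> E \<and> E \<subseteq> S}. P \<subseteq> E} = {join P l}"
        unfolding card_planes_point_line[OF P l(1) False] by auto
      then have "between P S = 1" using betw by simp
      then have "(q + 1) * c = (q + 1) * (q + 1)"
        using c below by (simp add: algebra_simps power2_eq_square)
      then show ?thesis using q_ge by (simp add: c_def)
    qed
  qed
qed

lemma solids_plane_line:
  assumes P: "P \<in> Points" "P \<subseteq> l" "P \<subseteq> E" and l: "l \<in> Lines" and E: "E \<in> Planes" and nl: "\<not> l \<subseteq> E"
  shows "{S \<in> Solids. E \<subseteq> S \<and> l \<subseteq> S} = {join E l}"
proof -
  obtain k where k: "E \<inter> l \<in> subs k" "k \<le> 2" "join E l \<in> subs (3 + 2 - k)"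
    using subs_Int_join[OF E l] by auto
  have "k \<noteq> 2"
  proof
    assume "k = 2"
    then have "E \<inter> l = l" using subs_eqI[of "E \<inter> l" 2 l] k l by simp
    then show False using nl by blast
  qed
  moreover have "1 \<le> k" using subs_dim_le[OF P(1) k(1)] P by simp
  ultimately have "k = 1" using k(2) by simp
  then have J: "join E l \<in> Solids" using k(3) by simp
  have "S = join E l" if "S \<in> Solids" "E \<subseteq> S" "l \<subseteq> S" for S
  proof -
    have "join E l \<subseteq> S" using subs_subspace[OF that(1)] that(2,3) by (rule join_least)
    then show ?thesis using subs_eqI[OF J that(1)] by simp
  qed
  then have "{S \<in> Solids. E \<subseteq> S \<and> l \<subseteq> S} \<subseteq> {join E l}" by blast
  moreover have "{join E l} \<subseteq> {S \<in> Solids. E \<subseteq> S \<and> l \<subseteq> S}"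
    using J join_upper1[of E l] join_upper2[of l E] by simp
  ultimately show ?thesis by (rule subset_antisym)
qed

text \<open>The line \<open>l0\<close> lies in every solid on \<open>E\<close> and excludes the
  second alternative of \<open>card_T_point_solid\<close>, so each of these solids has
  \<open>q + 1\<close> lines of \<open>T\<close> on \<open>P\<close>. Counting them determines how
  many lie in \<open>E\<close>. Thus two lines of \<open>T\<close> on \<open>P\<close> force their
  whole pencil into \<open>T\<close>.\<close>

lemma card_T_point_plane:
  assumes P: "P \<in> Points" and E: "E \<in> Planes" and PE: "P \<subseteq> E"
    and l0: "l0 \<in> Lines" "P \<subseteq> l0" "l0 \<subseteq> E" "l0 \<notin> T"
  shows "card {l \<in> T. P \<subseteq> l \<and> l \<subseteq> E} = 1"
proof -
  let ?SE = "{S \<in> Solids. E \<subseteq> S}" and ?TP = "{l \<in> T. P \<subseteq> l}"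
  define r where "r = int (card {l \<in> T. P \<subseteq> l \<and> l \<subseteq> E})"
  have "(\<Sum>S\<in>?SE. int (card {l \<in> ?TP. l \<subseteq> S})) = (\<Sum>S\<in>?SE. q + 1)"
  proof (rule sum.cong[OF refl])
    fix S assume S: "S \<in> ?SE"
    then have "l0 \<in> {l \<in> Lines. P \<subseteq> l \<and> l \<subseteq> S}" using l0 by auto
    moreover have "{l \<in> ?TP. l \<subseteq> S} = {l \<in> T. P \<subseteq> l \<and> l \<subseteq> S}" by auto
    ultimately show "int (card {l \<in> ?TP. l \<subseteq> S}) = q + 1"
      using card_T_point_solid[OF P, of S] S PE l0(4) by auto
  qed
  also have "\<dots> = (q\<^sup>2 + q + 1) * (q + 1)" using card_solids_plane[OF E] by simp
  finally have 1: "(\<Sum>S\<in>?SE. int (card {l \<in> ?TP. l \<subseteq> S})) = (q\<^sup>2 + q + 1) * (q + 1)" .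
  have "(\<Sum>S\<in>?SE. int (card {l \<in> ?TP. l \<subseteq> S})) = (\<Sum>l\<in>?TP. int (card {S \<in> ?SE. l \<subseteq> S}))"
    by (rule sum_card_swap) auto
  also have "\<dots> = (\<Sum>l\<in>?TP. if l \<subseteq> E then q\<^sup>2 + q + 1 else 1)"
  proof (rule sum.cong[OF refl])
    fix l assume l: "l \<in> ?TP"
    show "int (card {S \<in> ?SE. l \<subseteq> S}) = (if l \<subseteq> E then q\<^sup>2 + q + 1 else 1)"
    proof (cases "l \<subseteq> E")
      case True
      then have "{S \<in> ?SE. l \<subseteq> S} = ?SE" by auto
      then show ?thesis using card_solids_plane[OF E] True by simp
    next
      case False
      have "{S \<in> ?SE. l \<subseteq> S} = {S \<in> Solids. E \<subseteq> S \<and> l \<subseteq> S}" by auto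
      also have "\<dots> = {join E l}" using l False by (intro solids_plane_line[OF P _ PE _ E]) (auto simp: T_def)
      finally show ?thesis using False by simp
    qed
  qed
  also have "\<dots> = (q + 1) * (q\<^sup>2 + 1) + (q\<^sup>2 + q) * r"
  proof -
    have "{l \<in> ?TP. l \<subseteq> E} = {l \<in> T. P \<subseteq> l \<and> l \<subseteq> E}" by auto
    then show ?thesis using card_T_point[OF P] by (simp add: sum_if_card r_def)
  qed
  finally have "(q * (q + 1)) * r = (q * (q + 1)) * 1"
    using 1 by (simp add: algebra_simps power2_eq_square)
  moreover have "q * (q + 1) > 0" using q_ge by (intro mult_pos_pos) auto
  ultimately have "r = 1" by (subst (asm) mult_cancel_left) auto
  then show ?thesis by (simp add: r_def)
qed

section \<open>The orthogonality relation and its polarity\<close>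

text \<open>The first disjunct covers dependent pairs, which span no line; it makes every point
  absolute.\<close>

definition orth :: "'a ^ 6 \<Rightarrow> 'a ^ 6 \<Rightarrow> bool" where
  "orth u w \<longleftrightarrow> vec.dim {u, w} \<le> 1 \<or> vec.span {u, w} \<in> T"

lemma dim_pair_le: "vec.dim {u, w :: 'a ^ 6} \<le> 2"
  by (simp add: vec.dim_insert)

lemma span_point: "u \<noteq> 0 \<Longrightarrow> vec.span {u :: 'a ^ 6} \<in> Points"
  by (simp add: subs_def)

lemma orth_set_eq:
  assumes u: "u \<noteq> 0"
  shows "{w. orth u w} = \<Union> {l \<in> T. vec.span {u} \<subseteq> l}"
proof (intro equalityI subsetI)
  fix w assume w: "w \<in> {w. orth u w}"
  show "w \<in> \<Union> {l \<in> T. vec.span {u} \<subseteq> l}"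
  proof (cases "vec.span {u, w} \<in> T")
    case True
    moreover have "vec.span {u} \<subseteq> vec.span {u, w}" by (intro vec.span_mono) auto
    moreover have "w \<in> vec.span {u, w}" by (intro vec.span_base) auto
    ultimately show ?thesis by blast
  next
    case False
    then have "vec.dim {w, u} \<le> 1" using w by (simp add: orth_def insert_commute)
    then have "w \<in> vec.span {u}" using u by (simp add: vec.dim_insert[of w] split: if_splits)
    \<comment> \<open>A multiple of \<open>u\<close> is in the union only because some line of
      \<open>T\<close> passes through \<open>u\<close>.\<close>
    moreover have "{l \<in> T. vec.span {u} \<subseteq> l} \<noteq> {}"
    proof
      assume "{l \<in> T. vec.span {u} \<subseteq> l} = {}"
      then have "int (card {l \<in> T. vec.span {u} \<subseteq> l}) = 0" by (simp only: card.empty of_nat_0)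
      then have "(q + 1) * (q\<^sup>2 + 1) = 0" unfolding card_T_point[OF span_point[OF u]] .
      moreover have "(q + 1) * (q\<^sup>2 + 1) > 0" using q_ge by (intro mult_pos_pos add_nonneg_pos) auto
      ultimately show False by linarith
    qed
    ultimately show ?thesis by blast
  qed
next
  fix w assume "w \<in> \<Union> {l \<in> T. vec.span {u} \<subseteq> l}"
  then obtain l where l: "l \<in> T" "vec.span {u} \<subseteq> l" "w \<in> l" by blast
  have lL: "l \<in> Lines" using l by (simp add: T_def)
  have "orth u w"
  proof (cases "vec.dim {u, w} \<le> 1")
    case False
    then have "vec.dim {u, w} = 2" using dim_pair_le[of u w] by simp
    then have "vec.span {u, w} \<in> Lines" by (simp add: subs_def)
    moreover have "u \<in> l" using l(2) vec.span_base[of u "{u}"] by auto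
    then have "vec.span {u, w} \<subseteq> l"
      using l(3) subs_subspace[OF lL] by (intro vec.span_minimal) auto
    ultimately have "vec.span {u, w} = l" using subs_eqI lL by blast
    then show ?thesis using l(1) by (simp add: orth_def)
  qed (simp add: orth_def)
  then show "w \<in> {w. orth u w}" by simp
qed

text \<open>For the sum of vectors on two different lines of \<open>T\<close> through
  \<open>u\<close>, \<open>card_T_point_plane\<close> applies in the plane of these lines: all its
  lines through \<open>u\<close> belong to \<open>T\<close>.\<close>

lemma subspace_orth_set:
  assumes u: "u \<noteq> 0"
  shows "vec.subspace {w. orth u w}"
proof (rule vec.subspaceI)
  let ?P = "vec.span {u}"
  note P = span_point[OF u]
  have sub: "vec.subspace l" if "l \<in> T" for l using that by (simp add: T_def subs_def)
  show "0 \<in> {w. orth u w}" using u by (simp add: orth_def vec.dim_insert)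
  show "c *s w \<in> {w. orth u w}" if "w \<in> {w. orth u w}" for c w
    using that vec.subspace_scale[OF sub] unfolding orth_set_eq[OF u] by blast
  fix v w assume "v \<in> {w. orth u w}" "w \<in> {w. orth u w}"
  then obtain l m where l: "l \<in> T" "?P \<subseteq> l" "v \<in> l" and m: "m \<in> T" "?P \<subseteq> m" "w \<in> m"
    unfolding orth_set_eq[OF u] by blast
  have lL: "l \<in> Lines" and mL: "m \<in> Lines" using l m by (auto simp: T_def)
  have "\<exists>k\<in>T. ?P \<subseteq> k \<and> v + w \<in> k"
  proof (cases "l = m \<or> v + w \<in> ?P")
    case True
    then show ?thesis using l m vec.subspace_add[OF sub[OF l(1)], of v w] by blast
  next
    case False
    obtain i where i: "l \<inter> m \<in> subs i" "i \<le> 2" "join l m \<in> subs (2 + 2 - i)"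
      using subs_Int_join[OF lL mL] by auto
    have "i \<noteq> 2"
    proof
      assume "i = 2"
      then have "l \<inter> m \<in> Lines" using i by simp
      then have "l \<inter> m = l" "l \<inter> m = m" using lL mL subs_eqI by blast+
      then show False using False by simp
    qed
    moreover have "1 \<le> i" using subs_dim_le[OF P i(1)] l m by simp
    ultimately have "i = 1" using i(2) by simp
    then have E: "join l m \<in> Planes" using i(3) by simp
    let ?k = "vec.span (insert (v + w) ?P)"
    have "vec.dim ?k = 2" using False u by (simp add: vec.dim_insert vec.span_span)
    then have kL: "?k \<in> Lines" by (simp add: subs_def)
    have Pk: "?P \<subseteq> ?k" and vwk: "v + w \<in> ?k" by (auto intro: vec.span_base)
    have PE: "?P \<subseteq> join l m" using l(2) join_upper1[of l m] by blast
    have "v \<in> join l m" "w \<in> join l m" using l(3) m(3) join_upper1[of l m] join_upper2[of m l] by auto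
    then have "v + w \<in> join l m" using vec.subspace_add[OF subspace_join] by blast
    then have kE: "?k \<subseteq> join l m" using PE by (intro vec.span_minimal) auto
    have "?k \<in> T"
    proof (rule ccontr)
      assume "?k \<notin> T"
      then have "card {l' \<in> T. ?P \<subseteq> l' \<and> l' \<subseteq> join l m} = 1"
        using card_T_point_plane[OF P E PE kL Pk kE] by simp
      then obtain z where z: "{l' \<in> T. ?P \<subseteq> l' \<and> l' \<subseteq> join l m} = {z}" by (auto simp: card_1_singleton_iff)
      have "l \<in> {l' \<in> T. ?P \<subseteq> l' \<and> l' \<subseteq> join l m}" using l join_upper1[of l m] by simp
      moreover have "m \<in> {l' \<in> T. ?P \<subseteq> l' \<and> l' \<subseteq> join l m}" using m join_upper2[of m l] by simp
      ultimately have "l \<in> {z}" "m \<in> {z}" unfolding z by blast+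
      then show False using False by blast
    qed
    then show ?thesis using Pk vwk by blast
  qed
  then show "v + w \<in> {w. orth u w}" unfolding orth_set_eq[OF u] by blast
qed

text \<open>Found by counting vectors: the lines of \<open>T\<close> through \<open>u\<close>
  partition the vectors of \<open>?H\<close> outside \<open>?P\<close>, and
  \<open>q + (q + 1) * (q^2 + 1) * (q^2 - q) = q^5\<close>.\<close>

lemma dim_orth_set:
  assumes u: "u \<noteq> 0"
  shows "vec.dim {w. orth u w} = 5"
proof -
  let ?P = "vec.span {u}" and ?H = "{w. orth u w}" and ?T = "{l \<in> T. vec.span {u} \<subseteq> l}"
  note P = span_point[OF u]
  have card_P: "int (card ?P) = q" using card_subspace[of ?P] u by (simp add: q_def)
  have PH: "?P \<subseteq> ?H"
  proof
    fix w assume "w \<in> ?P"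
    then have "vec.dim {w, u} \<le> 1" using u by (simp add: vec.dim_insert)
    then show "w \<in> ?H" by (simp add: orth_def insert_commute)
  qed
  have card_l: "int (card (l - ?P)) = q\<^sup>2 - q" if l: "l \<in> ?T" for l
  proof -
    have lL: "l \<in> Lines" using l by (simp add: T_def)
    have "int (card l) = q\<^sup>2" using card_subspace[of l] lL by (simp add: subs_def q_def)
    moreover have "card ?P \<le> card l" using l by (intro card_mono) auto
    moreover have "card (l - ?P) = card l - card ?P" using l by (intro card_Diff_subset) auto
    ultimately show ?thesis using card_P by (simp add: of_nat_diff)
  qed
  have "?H - ?P = (\<Union>l\<in>?T. l - ?P)" unfolding orth_set_eq[OF u] by blast
  then have "card (?H - ?P) = (\<Sum>l\<in>?T. card (l - ?P))"
  proof (simp only:, intro card_UN_disjoint ballI impI)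
    fix l m assume lm: "l \<in> ?T" "m \<in> ?T" "l \<noteq> m"
    have lmL: "l \<in> subs (Suc 1)" "m \<in> subs (Suc 1)" using lm by (auto simp: T_def numeral_2_eq_2)
    have "l = m" if "v \<in> l" "v \<in> m" "v \<notin> ?P" for v
    proof -
      have "l = vec.span (insert v ?P)"
        using lm that by (intro subs_covers_unique[OF P lmL(1)]) auto
      moreover have "m = vec.span (insert v ?P)"
        using lm that by (intro subs_covers_unique[OF P lmL(2)]) auto
      ultimately show ?thesis by simp
    qed
    then show "(l - ?P) \<inter> (m - ?P) = {}" using lm(3) by blast
  qed auto
  then have "int (card (?H - ?P)) = (\<Sum>l\<in>?T. q\<^sup>2 - q)" using card_l by simp
  also have "\<dots> = (q + 1) * (q\<^sup>2 + 1) * (q\<^sup>2 - q)" using card_T_point[OF P] by simp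
  finally have "int (card (?H - ?P)) = (q + 1) * (q\<^sup>2 + 1) * (q\<^sup>2 - q)" .
  moreover have "card (?H - ?P) = card ?H - card ?P" using PH by (intro card_Diff_subset) auto
  moreover have "card ?P \<le> card ?H" using PH by (intro card_mono) auto
  ultimately have "int (card ?H) = q + (q + 1) * (q\<^sup>2 + 1) * (q\<^sup>2 - q)"
    using card_P by (simp add: of_nat_diff)
  also have "\<dots> = q ^ 5" by algebra
  finally have "q ^ vec.dim ?H = q ^ 5"
    using card_subspace[OF subspace_orth_set[OF u]] by (simp add: q_def)
  then show ?thesis using q_ge by simp
qed

lemma orthogonality_orth: "orthogonality orth"
proof
  fix u w :: "'a ^ 6"
  show "orth w u" if "orth u w" using that by (simp add: orth_def insert_commute)
  have zero: "{w. orth 0 w} = UNIV" by (auto simp: orth_def vec.dim_insert vec.span_zero)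
  show "vec.subspace {w. orth u w}"
    using subspace_orth_set zero by (cases "u = 0") auto
  show "CARD(6) \<le> Suc (vec.dim {w. orth u w})"
    using dim_orth_set[of u] zero by (cases "u = 0") (auto simp: vec_dim_card simp del: vec.dim_UNIV)
  show "u = 0" if "\<And>w. orth u w"
  proof (rule ccontr)
    assume "u \<noteq> 0"
    moreover have "{w. orth u w} = UNIV" using that by auto
    ultimately show False using dim_orth_set[of u] by (simp add: vec_dim_card del: vec.dim_UNIV)
  qed
qed

interpretation orthogonality orth by (rule orthogonality_orth)

lemma symplectic_polarity_perp: "symplectic_polarity perp"
  unfolding symplectic_polarity_def
proof (intro conjI ballI polarity_perp subsetI)
  fix P :: "('a ^ 6) set" and w assume P: "P \<in> pg_points" "w \<in> P"
  have "vec.dim {u, w} \<le> 1" if "u \<in> P" for u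
    using P that vec.dim_subset[of "{u, w}" P] by (auto simp: proj_subspaces_def)
  then show "w \<in> perp P" by (auto simp: perp_def orth_def)
qed

text \<open>For the converse, all lines of an isotropic plane belong to \<open>T\<close>, so their
  \<open>above\<close> values add up to \<open>(q + 1) * (q^2 + q + 1)\<close>; a plane outside
  \<open>L\<close> would give \<open>(q + 1)^2\<close>.\<close>

lemma L_eq_isotropic: "L = {E \<in> Planes. E \<subseteq> perp E}"
proof (intro equalityI subsetI)
  fix E assume E: "E \<in> L"
  then have EP: "E \<in> Planes" using L_planes by auto
  have "orth u w" if uw: "u \<in> E" "w \<in> E" for u w
  proof (cases "vec.dim {u, w} \<le> 1")
    case False
    then have "vec.dim {u, w} = 2" using dim_pair_le[of u w] by simp
    then have l: "vec.span {u, w} \<in> Lines" by (simp add: subs_def)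
    have "vec.span {u, w} \<subseteq> E" using uw subs_subspace[OF EP] by (intro vec.span_minimal) auto
    then have "E \<in> {E \<in> L. vec.span {u, w} \<subseteq> E}" using E by simp
    then have "above (vec.span {u, w}) \<noteq> 0" unfolding above_def by (auto simp: card_gt_0_iff)
    then show ?thesis using l by (simp add: orth_def T_def)
  qed (simp add: orth_def)
  then show "E \<in> {E \<in> Planes. E \<subseteq> perp E}" using EP by (auto simp: perp_def)
next
  fix E assume "E \<in> {E \<in> Planes. E \<subseteq> perp E}"
  then have E: "E \<in> Planes" and iso: "\<And>u w. u \<in> E \<Longrightarrow> w \<in> E \<Longrightarrow> orth u w" by (auto simp: perp_def)
  have "l \<in> T" if l: "l \<in> Lines" "l \<subseteq> E" for l
  proof -
    have dl: "vec.subspace l" "vec.dim l = 2" using l by (auto simp: subs_def)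
    obtain B where B: "B \<subseteq> l" "vec.span B = l" "card B = vec.dim l"
      using vec.basis_subspace_exists[OF dl(1)] by metis
    then obtain u w where uw: "B = {u, w}" using dl(2) by (auto simp: card_2_iff)
    have "vec.dim {u, w} = 2" using B uw dl vec.dim_span by metis
    moreover have "orth u w" using iso B uw l by auto
    ultimately show ?thesis using B uw by (simp add: orth_def)
  qed
  then have "{l \<in> {l \<in> Lines. l \<subseteq> E}. l \<in> T} = {l \<in> Lines. l \<subseteq> E}" by auto
  then have "(\<Sum>l | l \<in> Lines \<and> l \<subseteq> E. above l) = (q + 1) * (q\<^sup>2 + q + 1)"
    using sum_above_eq_card_T[of "{l \<in> Lines. l \<subseteq> E}"] card_lines_plane[OF E] by auto
  moreover have "(q + 1) * (q\<^sup>2 + q + 1) \<noteq> (q + 1)\<^sup>2"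
  proof
    assume "(q + 1) * (q\<^sup>2 + q + 1) = (q + 1)\<^sup>2"
    then have "(q + 1) * q\<^sup>2 = 0" by (simp add: algebra_simps power2_eq_square)
    then show False using q_ge by simp
  qed
  ultimately show "E \<in> L" using sum_above_plane[OF E] by (auto split: if_splits)
qed

lemma ex_symplectic_polarity:
  "\<exists>\<rho> :: ('a ^ 6) set \<Rightarrow> ('a ^ 6) set. symplectic_polarity \<rho> \<and> L = pg_planes \<inter> symplectic_polar_space \<rho>"
proof (intro exI conjI)
  show "symplectic_polarity perp" by (rule symplectic_polarity_perp)
  have "pg_planes \<inter> symplectic_polar_space perp = {E \<in> Planes. E \<subseteq> perp E}"
    by (auto simp: symplectic_polar_space_def totally_isotropic_def proj_subspaces_def subs_def)
  then show "L = pg_planes \<inter> symplectic_polar_space perp" using L_eq_isotropic by simp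
qed

end

theorem theorem4p12:
  fixes L :: "('a::{field,finite} ^ 6) set set"
    and q lambda2 x :: int
  assumes q_def: "q = int CARD('a)"
    and q_ge: "q \<ge> 25"
    and planes: "L \<subseteq> pg_planes"
    and nonempty: "L \<noteq> {}"
    and not_all: "L \<noteq> pg_planes"
    and lambda2_def: "lambda2 = q ^ 3 - q - 1"
    and x_def: "x = (q + 1) ^ 2"
    and card_L: "int (card L) = x * (q ^ 2 + 1) * (q ^ 2 - q + 1)"
    and inside: "\<forall>E\<in>L. int (card {F \<in> L. F \<noteq> E \<and> E \<inter> F \<in> pg_lines}) = lambda2 + x"
    and outside: "\<forall>E\<in>pg_planes - L. int (card {F \<in> L. E \<inter> F \<in> pg_lines}) = x"
    and lines: "\<forall>l\<in>pg_lines. int (card {E \<in> L. l \<subseteq> E}) \<le> x"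
    and solids: "\<forall>S\<in>pg_solids. int (card {E \<in> L. E \<subseteq> S}) \<le> x"
    and solids_pencil: "\<forall>S\<in>pg_solids. int (card {E \<in> L. E \<subseteq> S}) = q + 1 \<longrightarrow>
          (\<exists>l\<in>pg_lines. \<forall>E\<in>L. E \<subseteq> S \<longrightarrow> l \<subseteq> E)"
  shows "\<exists>\<rho> :: ('a ^ 6) set \<Rightarrow> ('a ^ 6) set.
           symplectic_polarity \<rho> \<and> L = pg_planes \<inter> symplectic_polar_space \<rho>"
proof -
  have pg: "(pg_lines :: ('a ^ 6) set set) = subs 2" "(pg_planes :: ('a ^ 6) set set) = subs 3"
    "(pg_solids :: ('a ^ 6) set set) = subs 4"
    by (simp_all add: proj_subspaces_eq_subs eval_nat_numeral)
  interpret regular_plane_set q L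
  proof
    show "q = int CARD('a)" "q \<ge> 25" by fact+
    show "L \<subseteq> subs 3" using planes unfolding pg .
    show "int (card L) = (q + 1)\<^sup>2 * (q\<^sup>2 + 1) * (q\<^sup>2 - q + 1)" using card_L x_def by simp
    fix E :: "('a ^ 6) set" assume E: "E \<in> subs 3"
    show "int (card {F \<in> L. F \<noteq> E \<and> E \<inter> F \<in> subs 2}) =
        (q + 1)\<^sup>2 + (if E \<in> L then q ^ 3 - q - 1 else 0)"
    proof (cases "E \<in> L")
      case True
      then show ?thesis using inside lambda2_def x_def unfolding pg by simp
    next
      case False
      then have "{F \<in> L. F \<noteq> E \<and> E \<inter> F \<in> subs 2} = {F \<in> L. E \<inter> F \<in> subs 2}" by auto
      then show ?thesis using outside E False x_def unfolding pg by simp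
    qed
  qed
  interpret bounded_plane_set q L
    using lines solids solids_pencil x_def unfolding pg
    by unfold_locales (auto simp: above_def below_def)
  show ?thesis by (rule ex_symplectic_polarity)
qed

end
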